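(* Let $X=(X_t)_{t\ge0}$ be an $\mathbf{R}^n$-valued Lévy process and $Y=(Y_t)_{t\ge0}$ an $\mathbf{R}^m$-valued Lévy process, independent of each other, and let $Z_t=(X_t,Y_t)$, $t\ge 0$. Assume that $X$, $Y$ and $Z$ have resolvent densities relative to the Lebesgue measures on $\mathbf{R}^n$, $\mathbf{R}^m$ and $\mathbf{R}^{n+m}$, respectively. Let $\lambda>0$. Suppose that $\nu$ is a finite measure on $\mathbf{R}^n\times\mathbf{R}^m$ of compact support which has finite $\lambda$-energy for $Z$. Then (i) the $\mathbf{R}^n$-marginal $\nu_1$ of $\nu$, $\nu_1(B)=\nu(B\times\mathbf{R}^m)$, has finite $\lambda$-energy for $X$; (ii) the $\mathbf{R}^m$-marginal $\nu_2$ of $\nu$, $\nu_2(B)=\nu(\mathbf{R}^n\times B)$, has finite $\lambda$-energy for $Y$.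
   Context: The Lévy-Khintchine exponent $\psi$ of an $\mathbf{R}^d$-valued Lévy process $W$ is defined by $E[\exp\{i\langle z,W_t\rangle\}]=\exp\{-t\psi(z)\}$, $z\in\mathbf{R}^d$, $t\ge0$. For a finite (positive) measure $\nu$ on $\mathbf{R}^d$ put $\hat\nu(z)=\int_{\mathbf{R}^d}e^{i\langle z,x\rangle}\nu(dx)$. For $\lambda>0$, the $\lambda$-energy of $\nu$ for $W$ is $$E_W^{\lambda}(\nu)=\int_{\mathbf{R}^d}\mathrm{Re}\left([\lambda+\psi(z)]^{-1}\right)|\hat\nu(z)|^2dz=\int_{\mathbf{R}^d}\frac{\lambda+\mathrm{Re}\,\psi(z)}{|\lambda+\psi(z)|^2}|\hat\nu(z)|^2dz .$$ $W$ has resolvent densities if for each $\alpha>0$ the resolvent kernel $U^\alpha(x,B)=E^x\int_0^\infty e^{-\alpha t}1_B(W_t)dt$ is absolutely continuous with respect to Lebesgue measure for every starting point $x$. *)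

theory Defs
  imports "HOL-Probability.Probability"
begin

definition cadlag :: "(real \<Rightarrow> 'b::euclidean_space) \<Rightarrow> bool" where
  "cadlag w \<longleftrightarrow> (\<forall>t\<ge>0. continuous (at_right t) w) \<and>
     (\<forall>t>0. \<exists>l. (w \<longlongrightarrow> l) (at_left t))"

text \<open>
  The time index is a real number; only the values \<^term>\<open>W t\<close> with \<open>0 \<le> t\<close> matter.
  The process starts at the origin; its law under starting point \<open>x\<close> is that of \<open>x + W\<close>.
\<close>

locale levy_process = prob_space M
  for M :: "'a measure" +
  fixes W :: "real \<Rightarrow> 'a \<Rightarrow> 'b::euclidean_space"
  assumes random_variable: "\<And>t. 0 \<le> t \<Longrightarrow> W t \<in> borel_measurable M"
    and start_zero: "AE \<omega> in M. W 0 \<omega> = 0"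
    and independent_increments:
      "\<And>(k::nat) (t::nat \<Rightarrow> real). 0 \<le> t 0 \<Longrightarrow> (\<And>i. i < k \<Longrightarrow> t i \<le> t (Suc i)) \<Longrightarrow>
         indep_vars (\<lambda>_. borel) (\<lambda>i \<omega>. W (t (Suc i)) \<omega> - W (t i) \<omega>) {..<k}"
    and stationary_increments:
      "\<And>s t. 0 \<le> s \<Longrightarrow> 0 \<le> t \<Longrightarrow>
         distr M borel (\<lambda>\<omega>. W (s + t) \<omega> - W s \<omega>) = distr M borel (W t)"
    and cadlag_paths: "AE \<omega> in M. cadlag (\<lambda>t. W t \<omega>)"

text \<open>
  For a Levy process, a number as below exists and is unique for every \<open>z\<close> (unique because
  the equation is required for all \<open>t \<ge> 0\<close> and not for a single time).
\<close>

definition levy_exponent ::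
    "'a measure \<Rightarrow> (real \<Rightarrow> 'a \<Rightarrow> 'b::euclidean_space) \<Rightarrow> 'b \<Rightarrow> complex" where
  "levy_exponent M W z =
     (THE c. \<forall>t\<ge>0. (LINT \<omega>|M. exp (\<i> * complex_of_real (z \<bullet> W t \<omega>))) =
                    exp (- (complex_of_real t * c)))"

definition fourier_transform :: "'b::euclidean_space measure \<Rightarrow> 'b \<Rightarrow> complex" where
  "fourier_transform \<nu> z = (LINT x|\<nu>. exp (\<i> * complex_of_real (z \<bullet> x)))"

text \<open>
  The energy takes values in \<open>[0, \<infinity>]\<close>. No truncation takes place in the coercion to
  \<^typ>\<open>ennreal\<close>: the real part of a Levy exponent is nonnegative, so the integrand is
  nonnegative when \<open>0 < lam\<close>.
\<close>

definition energy ::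
    "'a measure \<Rightarrow> (real \<Rightarrow> 'a \<Rightarrow> 'b::euclidean_space) \<Rightarrow> real \<Rightarrow> 'b measure \<Rightarrow> ennreal" where
  "energy M W lam \<nu> =
     (\<integral>\<^sup>+ z. ennreal (Re (inverse (complex_of_real lam + levy_exponent M W z)) *
                   (cmod (fourier_transform \<nu> z))\<^sup>2) \<partial>lborel)"

definition resolvent_kernel ::
    "'a measure \<Rightarrow> (real \<Rightarrow> 'a \<Rightarrow> 'b::euclidean_space) \<Rightarrow> real \<Rightarrow> 'b \<Rightarrow> 'b set \<Rightarrow> ennreal" where
  "resolvent_kernel M W \<alpha> x B =
     (\<integral>\<^sup>+ \<omega>. (\<integral>\<^sup>+ t\<in>{0..}. ennreal (exp (- \<alpha> * t)) * indicator B (x + W t \<omega>) \<partial>lborel) \<partial>M)"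

definition has_resolvent_densities ::
    "'a measure \<Rightarrow> (real \<Rightarrow> 'a \<Rightarrow> 'b::euclidean_space) \<Rightarrow> bool" where
  "has_resolvent_densities M W \<longleftrightarrow>
     (\<forall>\<alpha>>0. \<forall>x. \<forall>B\<in>null_sets lborel. resolvent_kernel M W \<alpha> x B = 0)"

definition process_events ::
    "'a measure \<Rightarrow> (real \<Rightarrow> 'a \<Rightarrow> 'b::euclidean_space) \<Rightarrow> 'a set set" where
  "process_events M W =
     sigma_sets (space M) {W t -` A \<inter> space M | t A. 0 \<le> t \<and> A \<in> sets borel}"

text \<open>
  The library notion \<open>indep_var\<close> asks for random variables of one type, so the
  independence of processes with different state spaces is expressed by the generated
  sigma-algebras.
\<close>

definition indep_processes ::
    "'a measure \<Rightarrow> (real \<Rightarrow> 'a \<Rightarrow> 'b::euclidean_space) \<Rightarrow>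
     (real \<Rightarrow> 'a \<Rightarrow> 'c::euclidean_space) \<Rightarrow> bool" where
  "indep_processes M X Y \<longleftrightarrow>
     prob_space.indep_set M (process_events M X) (process_events M Y)"

definition measure_support :: "'b::topological_space measure \<Rightarrow> 'b set" where
  "measure_support \<nu> = {x. \<forall>U. open U \<longrightarrow> x \<in> U \<longrightarrow> emeasure \<nu> U > 0}"

end

theory Submission
  imports Defs
begin

text \<open>
  Write \<open>a = \<lambda> + \<psi>\<^sub>X(z)\<close> and \<open>b = \<psi>\<^sub>Y(w)\<close>, so that by independence
  \<open>\<lambda> + \<psi>\<^sub>Z(z, w) = a + b\<close>. As the support of \<open>\<nu>\<close> is bounded, there is a rapidly decaying \<open>H\<close> whose
  Fourier transform is 1 on the projection of the support, whence
  \<open>\<nu>^(z, 0) = \<integral> H(w) \<nu>^(z, w) dw\<close>, and the Cauchy-Schwarz inequality gives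
  \<open>\<bar>\<nu>^(z, 0)\<bar>\<^sup>2 \<le> C \<integral> \<bar>H(w)\<bar> \<bar>\<nu>^(z, w)\<bar>\<^sup>2 dw\<close>. Since \<open>Re a \<ge> \<lambda>\<close> and \<open>Re b \<ge> 0\<close>,
  \<open>Re (1 / a) \<le> (1 + \<bar>b\<bar> / \<lambda>)\<^sup>2 Re (1 / (a + b))\<close>, and the growth of \<open>\<psi>\<^sub>Y\<close> is at most quadratic, so the
  decay of \<open>H\<close> absorbs the factor. Integrating over \<open>z\<close> bounds the energy of the marginal
  by a multiple of the energy of \<open>\<nu>\<close>. Quadratic growth follows from the continuity
  of \<open>\<psi>\<^sub>Y\<close> and the subadditivity of the square root of \<open>\<bar>\<psi>\<^sub>Y\<bar>\<close>.
\<close>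

section \<open>A reproducing kernel for measures of bounded support\<close>

text \<open>The function is sin t / t, obtained by integrating \<open>iexp (t * x)\<close> over
  [-1, 1]; its decay of order 1 is cubed in the next construction.\<close>

lemma cmod_char_uniform:
  "cmod (char (uniform_measure lborel {-1..1::real}) t) \<le> 1"
  "t \<noteq> 0 \<Longrightarrow> cmod (char (uniform_measure lborel {-1..1::real}) t) \<le> 1 / \<bar>t\<bar>"
proof -
  let ?U = "uniform_measure lborel {-1..1::real}"
  interpret U: prob_space ?U by (rule prob_space_uniform_measure) auto
  interpret U: real_distribution ?U by unfold_locales auto
  show "cmod (char ?U t) \<le> 1" by (rule U.cmod_char_le_1)
  assume t: "t \<noteq> 0"
  have "char ?U t = (CLBINT x:{-1..1}. iexp (t * x)) / 2"
  proof -
    have "?U = density lborel (\<lambda>x. ennreal (indicator {-1..1} x / 2))"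
      unfolding uniform_measure_def
      by (intro density_cong) (auto simp: indicator_def divide_ennreal[symmetric])
    then have "char ?U t = (CLBINT x. (indicator {-1..1} x / 2) *\<^sub>R iexp (t * x))"
      unfolding char_def by (simp add: integral_density)
    also have "\<dots> = (CLBINT x. (indicator {-1..1} x *\<^sub>R iexp (t * x)) / 2)"
      by (intro Bochner_Integration.integral_cong) (auto simp: scaleR_conv_of_real)
    finally show ?thesis by (simp add: set_lebesgue_integral_def)
  qed
  also have "(CLBINT x:{-1..1}. iexp (t * x)) = (CLBINT x=-1..1. iexp (t * x))"
    using interval_integral_Icc[of "-1" 1 "\<lambda>x. iexp (t * x)"] by (simp add: one_ereal_def)
  also have "\<dots> = (CLBINT x=ereal (-1)..ereal 1. iexp (t * x))"
    by (simp add: one_ereal_def)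
  also have "\<dots> = - \<i> / t * iexp (t * 1) - (- \<i> / t * iexp (t * (-1)))"
    using t by (intro interval_integral_FTC_finite)
       (auto intro!: derivative_eq_intros continuous_intros has_vector_derivative_real_field)
  finally have eq: "char ?U t = (- \<i> / t * iexp (t * 1) - (- \<i> / t * iexp (t * (-1)))) / 2" .
  have "cmod (- \<i> / t * iexp (t * 1) - (- \<i> / t * iexp (t * (-1))))
      \<le> cmod (- \<i> / t * iexp (t * 1)) + cmod (- \<i> / t * iexp (t * (-1)))"
    by (rule norm_triangle_ineq4)
  also have "\<dots> = 2 / \<bar>t\<bar>"
    unfolding norm_mult norm_exp_i_times by (simp add: norm_divide)
  finally show "cmod (char ?U t) \<le> 1 / \<bar>t\<bar>" unfolding eq by (simp add: norm_divide)
qed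

text \<open>Take the sum of three independent uniform variables on [-1, 1]: its characteristic
  function is the cube of the uniform one. Three factors, together with the 1 / t of the inversion
  formula, give the quartic decay that later balances the square of a quadratically growing
  exponent.\<close>

lemma exists_fast_decaying_char:
  obtains \<mu> :: "real measure" where "real_distribution \<mu>" "AE x in \<mu>. \<bar>x\<bar> \<le> 3"
    "\<And>t. t \<noteq> 0 \<Longrightarrow> cmod (char \<mu> t) \<le> 1 / \<bar>t\<bar> ^ 3"
proof -
  define U where "U = uniform_measure lborel {-1..1::real}"
  interpret U: prob_space U unfolding U_def by (rule prob_space_uniform_measure) auto
  have sU: "sets U = sets borel" "space U = UNIV" by (auto simp: U_def)
  have AEU: "AE x in U. \<bar>x\<bar> \<le> 1"
    unfolding U_def by (rule AE_uniform_measureI) auto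
  \<comment> \<open>Three copies of \<open>U\<close> on a product space; the coordinates are the
    independent variables.\<close>
  define P where "P = Pi\<^sub>M {..<3::nat} (\<lambda>_. U)"
  interpret Q: product_prob_space "\<lambda>_. U" "{..<3::nat}" by unfold_locales
  interpret P: prob_space P unfolding P_def by (rule prob_space_PiM) (rule U.prob_space_axioms)
  have comp: "(\<lambda>\<omega>. \<omega> i) \<in> borel_measurable P" if "i < 3" for i
    using measurable_component_singleton[of i "{..<3}" "\<lambda>_. U"] that
    by (simp add: P_def measurable_cong_sets[OF refl sU(1)])
  have dist: "distr P borel (\<lambda>\<omega>. \<omega> i) = U" if "i < 3" for i
  proof -
    have "distr P borel (\<lambda>\<omega>. \<omega> i) = distr P U (\<lambda>\<omega>. \<omega> i)"
      by (rule distr_cong) (auto simp: sU)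
    also have "\<dots> = U" unfolding P_def using that by (intro Q.PiM_component) auto
    finally show ?thesis .
  qed
  \<comment> \<open>Independence is read off from the joint law of the coordinates: it is
    \<open>P\<close>, already the product of their laws.\<close>
  have indep: "P.indep_vars (\<lambda>_. borel) (\<lambda>i \<omega>. \<omega> i) {..<3::nat}"
  proof (subst P.indep_vars_iff_distr_eq_PiM')
    show "{..<3::nat} \<noteq> {}" by (auto simp: lessThan_empty_iff)
    show "P.random_variable borel (\<lambda>\<omega>. \<omega> i)" if "i \<in> {..<3}" for i :: nat
      using comp that by auto
    have "distr P (Pi\<^sub>M {..<3} (\<lambda>_. borel)) (\<lambda>x. \<lambda>i\<in>{..<3}. x i) = distr P P (\<lambda>x. x)"
    proof (rule distr_cong)
      show "sets (Pi\<^sub>M {..<3} (\<lambda>_. borel)) = sets P"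
        unfolding P_def by (rule sets_PiM_cong) (auto simp: sU)
      show "(\<lambda>i\<in>{..<3}. x i) = x" if "x \<in> space P" for x
        using that by (auto simp: P_def space_PiM PiE_def extensional_restrict)
    qed simp
    also have "\<dots> = P" by simp
    also have "P = (\<Pi>\<^sub>M i\<in>{..<3}. distr P borel (\<lambda>\<omega>. \<omega> i))"
      using dist by (subst P_def) (intro PiM_cong, auto)
    finally show "distr P (Pi\<^sub>M {..<3} (\<lambda>_. borel)) (\<lambda>x. \<lambda>i\<in>{..<3}. x i) =
       (\<Pi>\<^sub>M i\<in>{..<3}. distr P borel (\<lambda>\<omega>. \<omega> i))" .
  qed
  define \<mu> where "\<mu> = distr P borel (\<lambda>\<omega>. \<Sum>i<3. \<omega> i)"
  have meas: "(\<lambda>\<omega>. \<Sum>i<3. \<omega> i) \<in> borel_measurable P"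
    using comp by (intro borel_measurable_sum) auto
  have "char \<mu> t = char U t ^ 3" for t
    unfolding \<mu>_def by (subst P.char_distr_sum[OF indep]) (simp add: dist)
  then have decay: "cmod (char \<mu> t) \<le> 1 / \<bar>t\<bar> ^ 3" if "t \<noteq> 0" for t
    using power_mono[OF cmod_char_uniform(2)[OF that] norm_ge_zero, of 3]
    by (simp add: norm_power U_def power_divide)
  have "real_distribution \<mu>"
    unfolding \<mu>_def using meas by (rule P.real_distribution_distr)
  moreover have "AE x in \<mu>. \<bar>x\<bar> \<le> 3"
  proof -
    have "AE \<omega> in P. \<bar>\<omega> i\<bar> \<le> 1" if "i < 3" for i
      using AE_distrD[of "\<lambda>\<omega>. \<omega> i" P borel "\<lambda>x. \<bar>x\<bar> \<le> 1"] comp[OF that] AEU dist[OF that] by auto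
    then have "AE \<omega> in P. \<forall>i\<in>{..<3}. \<bar>\<omega> i\<bar> \<le> 1" by (intro AE_finite_allI) auto
    then have "AE \<omega> in P. \<bar>\<Sum>i<3. \<omega> i\<bar> \<le> 3"
    proof (rule AE_mp, intro AE_I2 impI)
      fix \<omega> :: "nat \<Rightarrow> real" assume *: "\<forall>i\<in>{..<3}. \<bar>\<omega> i\<bar> \<le> 1"
      have "\<bar>\<Sum>i<3. \<omega> i\<bar> \<le> (\<Sum>i<3. \<bar>\<omega> i\<bar>)" by (rule sum_abs)
      also have "\<dots> \<le> (\<Sum>i<3::nat. 1)" using * by (intro sum_mono) auto
      finally show "\<bar>\<Sum>i<3. \<omega> i\<bar> \<le> 3" by simp
    qed
    then show ?thesis unfolding \<mu>_def by (subst AE_distr_iff[OF meas]) auto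
  qed
  ultimately show thesis using decay by (rule that)
qed

lemma integrable_quartic_decay: "integrable lborel (\<lambda>t::real. 1 / (1 + \<bar>t\<bar>) ^ 4)"
proof (rule Bochner_Integration.integrable_bound)
  have "set_integrable lborel UNIV (\<lambda>x::real. inverse (1 + x\<^sup>2))"
    using integrable_inverse_1_plus_square by simp
  then show "integrable lborel (\<lambda>x::real. inverse (1 + x\<^sup>2))"
    by (simp add: set_integrable_def)
  show "AE t::real in lborel. norm (1 / (1 + \<bar>t\<bar>) ^ 4) \<le> norm (inverse (1 + t\<^sup>2))"
  proof (intro AE_I2)
    fix t :: real
    have "1 + t\<^sup>2 \<le> (1 + \<bar>t\<bar>) ^ 2" by (simp add: power2_sum)
    also have "\<dots> \<le> (1 + \<bar>t\<bar>) ^ 4" by (intro power_increasing) auto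
    finally show "norm (1 / (1 + \<bar>t\<bar>) ^ 4) \<le> norm (inverse (1 + t\<^sup>2))"
      by (auto simp: inverse_eq_divide add_nonneg_nonneg intro!: divide_left_mono mult_pos_pos add_pos_nonneg)
  qed
qed simp

lemma integrable_mult_iexp_of_quartic_decay:
  fixes h :: "real \<Rightarrow> complex"
  assumes [measurable]: "h \<in> borel_measurable borel" and le: "\<And>t. cmod (h t) \<le> C / (1 + \<bar>t\<bar>) ^ 4"
  shows "integrable lborel (\<lambda>t. h t * iexp (t * y))"
proof (rule Bochner_Integration.integrable_bound)
  show "integrable lborel (\<lambda>t. C * (1 / (1 + \<bar>t\<bar>) ^ 4))"
    by (intro integrable_mult_right integrable_quartic_decay)
  show "AE t in lborel. norm (h t * iexp (t * y)) \<le> norm (C * (1 / (1 + \<bar>t\<bar>) ^ 4))"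
    using order_trans[OF le abs_ge_self] by (intro AE_I2) (simp add: norm_mult)
qed simp

text \<open>
  Levy's inversion formula for the sum of three uniform variables, applied to an interval of
  radius \<open>L = R + 4\<close> around \<open>- y\<close>, which contains the support when \<open>\<bar>y\<bar> \<le> R\<close>.
\<close>

lemma exists_reproducing_kernel_real:
  fixes R :: real
  assumes "0 \<le> R"
  obtains h :: "real \<Rightarrow> complex" and C :: real where
    "h \<in> borel_measurable borel" "\<And>t. cmod (h t) \<le> C / (1 + \<bar>t\<bar>) ^ 4"
    "\<And>y. \<bar>y\<bar> \<le> R \<Longrightarrow> (LINT t|lborel. h t * iexp (t * y)) = 1"
proof -
  obtain \<mu> :: "real measure" where mu: "real_distribution \<mu>" "AE x in \<mu>. \<bar>x\<bar> \<le> 3"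
    and dec: "\<And>t. t \<noteq> 0 \<Longrightarrow> cmod (char \<mu> t) \<le> 1 / \<bar>t\<bar> ^ 3"
    using exists_fast_decaying_char by blast
  interpret real_distribution \<mu> by fact
  define L where "L = R + 4"
  have L: "L \<ge> 4" using assms by (simp add: L_def)
  \<comment> \<open>The inversion integrand for the interval from -L to L; the shift by -y becomes
    the separate factor \<open>iexp (t * y)\<close>, so \<open>h\<close> does not depend on y. At t
    = 0 the division gives 0 where the continuous extension has the value L / pi; one point does not
    affect the integrals.\<close>
  define h where "h t = 1 / (2 * pi) * ((iexp (t * L) - iexp (t * (-L))) / (\<i> * t) * char \<mu> t)" for t
  have meas [measurable]: "h \<in> borel_measurable borel"
    unfolding h_def using char_measurable by measurable
  \<comment> \<open>For |t| \<le> 1 the constant is 2 * L times 2 ^ 4; for larger |t| the factor 16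
    is enough, which L \<ge> 4 covers.\<close>
  define C where "C = 32 * L"
  have bound: "cmod (h t) \<le> C / (1 + \<bar>t\<bar>) ^ 4" for t
  proof (cases "\<bar>t\<bar> \<le> 1")
    case True
    have "cmod (h t) \<le> 2 * L"
    proof (cases "t = 0")
      case False
      have "cmod ((iexp (t * L) - iexp (t * (-L))) / (\<i> * t)) \<le> L - (-L)"
        using L False by (intro Levy_Inversion_aux2) auto
      then have "cmod (h t) \<le> 1 / (2 * pi) * ((L - (-L)) * 1)"
        unfolding h_def norm_mult using L cmod_char_le_1[of t]
        by (intro mult_mono) (auto simp: norm_divide norm_mult)
      also have "\<dots> \<le> 2 * L" using L pi_gt3 by (simp add: field_simps)
      finally show ?thesis .
    qed (use L in \<open>simp add: h_def\<close>)
    moreover have "(1 + \<bar>t\<bar>) ^ 4 \<le> 2 ^ 4" using True by (intro power_mono) auto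
    ultimately have "cmod (h t) * (1 + \<bar>t\<bar>) ^ 4 \<le> (2 * L) * 2 ^ 4" using L by (intro mult_mono) auto
    then show ?thesis by (simp add: C_def pos_le_divide_eq add_pos_nonneg algebra_simps)
  next
    case False
    then have t: "t \<noteq> 0" by auto
    have "cmod (iexp (t * L) - iexp (t * (-L))) \<le> 2"
      using norm_triangle_ineq4[of "iexp (t * L)" "iexp (t * (-L))"] by simp
    then have "cmod ((iexp (t * L) - iexp (t * (-L))) / (\<i> * t)) \<le> 2 / \<bar>t\<bar>"
      by (simp add: norm_divide norm_mult divide_right_mono)
    then have "cmod (h t) \<le> 1 / (2 * pi) * (2 / \<bar>t\<bar> * (1 / \<bar>t\<bar> ^ 3))"
      unfolding h_def norm_mult using dec[OF t]
      by (intro mult_mono) (auto simp: norm_divide norm_mult)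
    also have "\<dots> = 1 / pi * (1 / \<bar>t\<bar> ^ 4)" by (simp add: field_simps eval_nat_numeral)
    also have "\<dots> \<le> 1 * (1 / \<bar>t\<bar> ^ 4)" using pi_gt3 by (intro mult_right_mono) auto
    also have "\<dots> \<le> C / (1 + \<bar>t\<bar>) ^ 4"
    proof -
      have "(1 + \<bar>t\<bar>) ^ 4 \<le> (2 * \<bar>t\<bar>) ^ 4" using False by (intro power_mono) auto
      also have "\<dots> = 16 * \<bar>t\<bar> ^ 4" by (simp add: power_mult_distrib)
      also have "\<dots> \<le> C * \<bar>t\<bar> ^ 4" unfolding C_def using L by (intro mult_right_mono) auto
      finally show ?thesis using t by (simp add: divide_simps)
    qed
    finally show ?thesis .
  qed
  have int: "integrable lborel (\<lambda>t. h t * iexp (t * y))" for y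
    using meas bound by (rule integrable_mult_iexp_of_quartic_decay)
  have rep: "(LINT t|lborel. h t * iexp (t * y)) = 1" if y: "\<bar>y\<bar> \<le> R" for y
  proof -
    \<comment> \<open>As \<open>\<mu>\<close> lives on [-3, 3] and L = R + 4, the ends lie at or
      beyond -4 and 4: they are not atoms, and the interval has full mass.\<close>
    define a b where "a = - y - L" and "b = - y + L"
    have AEx: "AE x in \<mu>. x \<in> {a<..b}" and nab: "AE x in \<mu>. x \<noteq> a" "AE x in \<mu>. x \<noteq> b"
      by (rule AE_mp[OF mu(2)], rule AE_I2, use y in \<open>auto simp: a_def b_def L_def\<close>)+
    have "measure \<mu> {a} = 0" "measure \<mu> {b} = 0"
      using nab by (auto simp: prob_eq_0)
    moreover have "measure \<mu> {a<..b} = 1" using AEx by (subst prob_eq_1) auto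
    moreover have "a \<le> b" using L by (simp add: a_def b_def)
    ultimately have lim: "(\<lambda>T::nat. 1 / (2 * pi) * (CLBINT t=-T..T. (iexp (-(t * a)) - iexp (-(t * b))) / (\<i> * t) * char \<mu> t)) \<longlonglongrightarrow> 1"
      using Levy_Inversion[of a b] by simp
    have eq: "1 / (2 * pi) * ((iexp (-(t * a)) - iexp (-(t * b))) / (\<i> * t) * char \<mu> t) = h t * iexp (t * y)" for t
    proof -
      have "-(t*a) = t * y + t * L" "-(t*b) = t * y + t * (-L)" by (auto simp: a_def b_def algebra_simps)
      moreover have "iexp (u + v) = iexp u * iexp v" for u v :: real
        by (simp add: distrib_left exp_add)
      ultimately have "iexp (-(t * a)) - iexp (-(t * b)) = (iexp (t * L) - iexp (t * (-L))) * iexp (t * y)"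
        by (simp only: left_diff_distrib right_diff_distrib mult.commute)
      then show ?thesis unfolding h_def by simp
    qed
    have "1 / (2 * pi) * (CLBINT t=-T..T. (iexp (-(t * a)) - iexp (-(t * b))) / (\<i> * t) * char \<mu> t)
       = (LINT t|lborel. indicator {-real T..real T} t *\<^sub>R (h t * iexp (t * y)))" for T :: nat
    proof -
      have "1 / (2 * pi) * (CLBINT t=-T..T. (iexp (-(t * a)) - iexp (-(t * b))) / (\<i> * t) * char \<mu> t)
        = (CLBINT t=-T..T. 1 / (2 * pi) * ((iexp (-(t * a)) - iexp (-(t * b))) / (\<i> * t) * char \<mu> t))"
        by (rule interval_lebesgue_integral_mult_right[symmetric])
      also have "\<dots> = (CLBINT t=-T..T. h t * iexp (t * y))" unfolding eq ..
      also have "\<dots> = (LINT t:{-real T..real T}|lborel. h t * iexp (t * y))"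
        by (subst interval_integral_Icc[symmetric]) auto
      finally show ?thesis by (simp add: set_lebesgue_integral_def)
    qed
    with lim have lim1: "(\<lambda>T. LINT t|lborel. indicator {-real T..real T} t *\<^sub>R (h t * iexp (t * y))) \<longlonglongrightarrow> 1"
      by simp
    \<comment> \<open>Inversion yields only symmetric truncated integrals; since the integrand is
      integrable, they converge to the full integral.\<close>
    have "(\<lambda>T. LINT t|lborel. indicator {-real T..real T} t *\<^sub>R (h t * iexp (t * y))) \<longlonglongrightarrow> (LINT t|lborel. h t * iexp (t * y))"
    proof (rule integral_dominated_convergence[where w="\<lambda>t. norm (h t * iexp (t * y))"])
      show "AE t in lborel. (\<lambda>T. indicator {-real T..real T} t *\<^sub>R (h t * iexp (t * y))) \<longlonglongrightarrow> h t * iexp (t * y)"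
      proof (intro AE_I2 tendsto_eventually)
        fix t :: real
        obtain N :: nat where "\<bar>t\<bar> \<le> N" using real_arch_simple by blast
        then show "eventually (\<lambda>T. indicator {-real T..real T} t *\<^sub>R (h t * iexp (t * y)) = h t * iexp (t * y)) sequentially"
          by (intro eventually_sequentiallyI[of N]) (auto simp: indicator_def)
      qed
      show "integrable lborel (\<lambda>t. norm (h t * iexp (t * y)))" by (intro integrable_norm int)
    qed (auto simp: indicator_def)
    with lim1 show ?thesis by (rule LIMSEQ_unique[symmetric])
  qed
  show thesis using meas bound rep by (rule that)
qed

section \<open>From the line to Euclidean spaces\<close>

text \<open>\<open>lborel\<close> is the image of a product of one-dimensional Lebesgue measures
  under the map from coordinates to vectors, so Fubini factors such integrals.\<close>

lemma
  fixes f :: "'b::euclidean_space \<Rightarrow> real \<Rightarrow> complex"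
  assumes "\<And>b. b \<in> Basis \<Longrightarrow> integrable lborel (f b)"
  shows integrable_lborel_prod_Basis: "integrable lborel (\<lambda>x::'b. \<Prod>b\<in>Basis. f b (x \<bullet> b))"
    and integral_lborel_prod_Basis:
      "(LINT x|lborel. (\<Prod>b\<in>Basis. f b (x \<bullet> b))) = (\<Prod>b\<in>Basis. LINT t|lborel. f b t)"
proof -
  interpret product_sigma_finite "\<lambda>_::'b. lborel :: real measure" ..
  have meas: "(\<lambda>x::'b. \<Prod>b\<in>Basis. f b (x \<bullet> b)) \<in> borel_measurable borel"
    by (intro borel_measurable_prod) (auto intro: measurable_compose[OF _ borel_measurable_integrable[OF assms, simplified]])
  have eq: "(\<Prod>b\<in>Basis. f b ((\<Sum>c\<in>Basis. g c *\<^sub>R c) \<bullet> b)) = (\<Prod>b\<in>Basis. f b (g b))" for g :: "'b \<Rightarrow> real"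
    by (intro prod.cong) (auto simp: inner_sum_left_Basis)
  show "integrable lborel (\<lambda>x::'b. \<Prod>b\<in>Basis. f b (x \<bullet> b))"
    using product_integrable_prod[OF finite_Basis assms]
    by (subst lborel_eq, subst integrable_distr_eq) (auto simp: meas eq)
  show "(LINT x|lborel. (\<Prod>b\<in>Basis. f b (x \<bullet> b))) = (\<Prod>b\<in>Basis. LINT t|lborel. f b t)"
    using product_integral_prod[OF finite_Basis assms]
    by (subst lborel_eq, subst integral_distr) (auto simp: meas eq)
qed

text \<open>Expanding the product leaves at least 1 plus the l1 norm. This turns decay in each
  coordinate into decay in the norm.\<close>

lemma one_plus_norm_le_prod: "1 + norm (x::'b::euclidean_space) \<le> (\<Prod>b\<in>Basis. 1 + \<bar>x \<bullet> b\<bar>)"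
proof -
  have gen: "1 + (\<Sum>b\<in>A. u b) \<le> (\<Prod>b\<in>A. 1 + u b)" if "finite A" "\<And>b. u b \<ge> 0"
    for A and u :: "'b \<Rightarrow> real"
    using that(1)
  proof induction
    case (insert a A)
    have "1 + (\<Sum>b\<in>insert a A. u b) \<le> (1 + u a) * (1 + (\<Sum>b\<in>A. u b))"
      using insert that(2) by (simp add: algebra_simps sum_nonneg)
    also have "\<dots> \<le> (1 + u a) * (\<Prod>b\<in>A. 1 + u b)"
      using insert that(2) by (intro mult_left_mono) (auto simp: add_nonneg_nonneg)
    finally show ?case using insert by simp
  qed simp
  show ?thesis using norm_le_l1[of x] gen[of Basis "\<lambda>b. \<bar>x \<bullet> b\<bar>"] by simp
qed

text \<open>The tensor product of one-dimensional kernels works because each coordinate of y is at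
  most \<open>norm y\<close>. Integrability comes from the product form, as decay of order 4 in the
  norm does not suffice from dimension 4 on.\<close>

lemma exists_reproducing_kernel:
  fixes R :: real
  assumes "0 \<le> R"
  obtains H :: "'b::euclidean_space \<Rightarrow> complex" and C :: real where
    "integrable lborel H" "\<And>w. cmod (H w) \<le> C / (1 + norm w) ^ 4"
    "\<And>y. norm y \<le> R \<Longrightarrow> (LINT w|lborel. H w * iexp (w \<bullet> y)) = 1"
proof -
  obtain h :: "real \<Rightarrow> complex" and C :: real where
    meas [measurable]: "h \<in> borel_measurable borel" and le: "\<And>t. cmod (h t) \<le> C / (1 + \<bar>t\<bar>) ^ 4"
    and rep: "\<And>y. \<bar>y\<bar> \<le> R \<Longrightarrow> (LINT t|lborel. h t * iexp (t * y)) = 1"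
    using exists_reproducing_kernel_real[OF assms] by blast
  have C: "C \<ge> 0" using order_trans[OF norm_ge_zero le[of 0]] by simp
  have int: "integrable lborel (\<lambda>t. h t * iexp (t * y))" for y
    using meas le by (rule integrable_mult_iexp_of_quartic_decay)
  define H where "H w = (\<Prod>b\<in>Basis. h (w \<bullet> b))" for w :: 'b
  have "integrable lborel H"
    unfolding H_def using int[of 0] by (intro integrable_lborel_prod_Basis) simp
  moreover have "cmod (H w) \<le> C ^ DIM('b) / (1 + norm w) ^ 4" for w
  proof -
    have "cmod (H w) \<le> (\<Prod>b\<in>(Basis::'b set). C / (1 + \<bar>w \<bullet> b\<bar>) ^ 4)"
      unfolding H_def prod_norm[symmetric] by (intro prod_mono) (auto simp: le)
    also have "\<dots> = C ^ DIM('b) / (\<Prod>b\<in>Basis. 1 + \<bar>w \<bullet> b\<bar>) ^ 4"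
      by (simp add: prod_dividef prod_power_distrib)
    also have "\<dots> \<le> C ^ DIM('b) / (1 + norm w) ^ 4"
    proof (intro divide_left_mono power_mono one_plus_norm_le_prod)
      have "0 < 1 + norm w" by (simp add: add_pos_nonneg)
      with one_plus_norm_le_prod[of w] show "0 < (\<Prod>b\<in>Basis. 1 + \<bar>w \<bullet> b\<bar>) ^ 4 * (1 + norm w) ^ 4"
        by (intro mult_pos_pos zero_less_power) linarith+
    qed (use C in auto)
    finally show ?thesis .
  qed
  moreover have "(LINT w|lborel. H w * iexp (w \<bullet> y)) = 1" if "norm y \<le> R" for y :: 'b
  proof -
    have "H w * iexp (w \<bullet> y) = (\<Prod>b\<in>Basis. h (w \<bullet> b) * iexp ((w \<bullet> b) * (y \<bullet> b)))" for w
      unfolding H_def by (subst euclidean_inner)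
        (simp add: prod.distrib exp_sum[symmetric] sum_distrib_left)
    then have "(LINT w|lborel. H w * iexp (w \<bullet> y)) = (\<Prod>b\<in>(Basis::'b set). LINT t|lborel. h t * iexp (t * (y \<bullet> b)))"
      using integral_lborel_prod_Basis[of "\<lambda>b t. h t * iexp (t * (y \<bullet> b))"] int by simp
    also have "\<dots> = (\<Prod>b\<in>(Basis::'b set). 1)"
      using that Basis_le_norm[of _ y] by (intro prod.cong refl rep) (auto intro: order_trans)
    finally show ?thesis by simp
  qed
  ultimately show thesis by (rule that)
qed

section \<open>The exponent of a Levy process\<close>

text \<open>Equality at a single time t fixes c only up to multiples of 2 pi i / t, so a small t is
  used.\<close>

lemma exp_semigroup_unique:
  fixes c d :: complex
  assumes "\<And>t::real. 0 \<le> t \<Longrightarrow> exp (- (complex_of_real t * c)) = exp (- (complex_of_real t * d))"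
  shows "c = d"
proof -
  \<comment> \<open>This forces |t * Im (d - c)| < 1, below 2 pi, which leaves only the zero
    multiple.\<close>
  define t where "t = 1 / (1 + \<bar>Im (d - c)\<bar>)"
  have t0: "0 < t" unfolding t_def by (simp add: add_pos_nonneg)
  have t1: "\<bar>t * Im (d - c)\<bar> < 1"
    unfolding t_def abs_mult by (simp add: pos_divide_less_eq add_pos_nonneg)
  have "exp (complex_of_real t * (d - c)) = exp (- (complex_of_real t * c)) / exp (- (complex_of_real t * d))"
    by (simp add: exp_diff[symmetric] right_diff_distrib)
  also have "\<dots> = 1" using assms[of t] t0 by simp
  finally obtain n :: int where n: "t * Re (d - c) = 0" "t * Im (d - c) = of_int (2 * n) * pi"
    unfolding exp_eq_1 by auto
  have "n = 0"
  proof (rule ccontr)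
    assume "n \<noteq> 0"
    then have "1 \<le> \<bar>2 * n\<bar>" by linarith
    then have "1 \<le> \<bar>of_int (2 * n) :: real\<bar>" by linarith
    then have "1 * 1 \<le> \<bar>of_int (2 * n) :: real\<bar> * \<bar>pi\<bar>" using pi_gt3 by (intro mult_mono) auto
    with t1 show False unfolding n(2) abs_mult by linarith
  qed
  with n t0 show ?thesis by (simp add: complex_eq_iff)
qed

lemma levy_exponent_eqI:
  assumes "\<And>t. 0 \<le> t \<Longrightarrow> (LINT \<omega>|M. iexp (z \<bullet> W t \<omega>)) = exp (- (complex_of_real t * c))"
  shows "levy_exponent M W z = c"
  unfolding levy_exponent_def
proof (rule the_equality)
  show "\<forall>t\<ge>0. (LINT \<omega>|M. iexp (z \<bullet> W t \<omega>)) = exp (- (complex_of_real t * c))"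
    using assms by blast
  show "d = c" if "\<forall>t\<ge>0. (LINT \<omega>|M. iexp (z \<bullet> W t \<omega>)) = exp (- (complex_of_real t * d))" for d
    by (rule exp_semigroup_unique) (rule trans[OF that[rule_format, symmetric] assms])
qed

text \<open>
  A continuous multiplicative \<open>f\<close> is differentiable because
  \<open>f t * integral {0..a} f = integral {t..t + a} f\<close>, where \<open>a\<close> is chosen so small that the
  integral on the left does not vanish.
\<close>

lemma continuous_multiplicative_imp_exp:
  fixes f :: "real \<Rightarrow> complex"
  assumes add: "\<And>s t. 0 \<le> s \<Longrightarrow> 0 \<le> t \<Longrightarrow> f (s + t) = f s * f t"
    and bound: "\<And>t. 0 \<le> t \<Longrightarrow> cmod (f t) \<le> 1"
    and lim: "(f \<longlongrightarrow> 1) (at_right 0)" and f0: "f 0 = 1"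
  obtains c where "\<And>t. 0 \<le> t \<Longrightarrow> f t = exp (- (complex_of_real t * c))"
proof -
  \<comment> \<open>As |f s| \<le> 1, increments at any time are controlled by those at 0, so right
    continuity at 0 spreads to continuity on \<open>{0..}\<close>.\<close>
  have diff: "cmod (f t - f s) \<le> cmod (f (t - s) - 1)" if "0 \<le> s" "s \<le> t" for s t
  proof -
    have "f t - f s = f s * (f (t - s) - 1)" using add[of s "t - s"] that by (simp add: algebra_simps)
    also have "cmod \<dots> \<le> 1 * cmod (f (t - s) - 1)"
      unfolding norm_mult using bound that by (intro mult_right_mono) auto
    finally show ?thesis by simp
  qed
  have near: "\<exists>d>0. \<forall>t. 0 \<le> t \<longrightarrow> t < d \<longrightarrow> cmod (f t - 1) < e" if "e > 0" for e
  proof -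
    from tendstoD[OF lim that] obtain d where "d > 0" "\<forall>t>0. t < d \<longrightarrow> dist (f t) 1 < e"
      unfolding eventually_at_right_field by blast
    then have "\<forall>t. 0 \<le> t \<longrightarrow> t < d \<longrightarrow> cmod (f t - 1) < e"
      using f0 that by (auto simp: dist_norm order_le_less)
    with \<open>d > 0\<close> show ?thesis by blast
  qed
  have cont: "continuous_on {0..} f"
    unfolding continuous_on_iff
  proof (intro ballI allI impI)
    fix x e :: real assume x: "x \<in> {0..}" and e: "0 < e"
    obtain d where d: "d > 0" "\<And>t. 0 \<le> t \<Longrightarrow> t < d \<Longrightarrow> cmod (f t - 1) < e" using near[OF e] by blast
    have "dist (f x') (f x) < e" if "x' \<in> {0..}" "dist x' x < d" for x'
    proof (cases "x \<le> x'")
      case True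
      then show ?thesis using diff[of x x'] d(2)[of "x' - x"] x that by (simp add: dist_norm)
    next
      case False
      then show ?thesis using diff[of x' x] d(2)[of "x - x'"] x that
        by (simp add: dist_norm norm_minus_commute)
    qed
    with d(1) show "\<exists>d>0. \<forall>x'\<in>{0..}. dist x' x < d \<longrightarrow> dist (f x') (f x) < e" by blast
  qed
  obtain d where d: "d > 0" "\<And>t. 0 \<le> t \<Longrightarrow> t < d \<Longrightarrow> cmod (f t - 1) < 1/2"
    using near[of "1/2"] by auto
  define a where "a = d / 2"
  have a: "a > 0" "a < d" using d by (auto simp: a_def)
  have intf: "f integrable_on {s..t}" if "0 \<le> s" for s t
    using that by (intro integrable_continuous_real continuous_on_subset[OF cont]) auto
  define A where "A = integral {0..a} f"
  \<comment> \<open>On [0, a] the values stay within 1/2 of 1, so \<open>A\<close> is within a / 2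
    of a and cannot vanish.\<close>
  have "cmod (integral {0..a} (\<lambda>t. f t - 1)) \<le> 1/2 * (a - 0)"
    using a d(2) by (intro integral_bound continuous_intros continuous_on_subset[OF cont])
      (auto intro!: less_imp_le)
  also have "integral {0..a} (\<lambda>t. f t - 1) = A - of_real a"
    unfolding A_def using a intf[of 0 a] by (subst integral_diff) (auto simp: scaleR_conv_of_real)
  finally have "A \<noteq> 0" using a by auto
  have shift: "f t * A = integral {0..t+a} f - integral {0..t} f" if t: "0 \<le> t" for t
  proof -
    have "f t * A = integral {0..a} (\<lambda>s. f t * f s)" by (simp add: A_def)
    also have "\<dots> = integral {0..a} (\<lambda>s. f (s + t))"
      using t by (intro integral_cong) (auto simp: add mult.commute)
    also have "\<dots> = integral {0 + t..a + t} f"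
      using integral_shift_real_ivl[of "0 + t" t "a + t" f] by simp
    also have "\<dots> = integral {0..t+a} f - integral {0..t} f"
      using Henstock_Kurzweil_Integration.integral_combine[of 0 t "t + a" f] intf[of 0 "t+a"] t a
      by (simp add: algebra_simps)
    finally show ?thesis .
  qed
  define F where "F t = integral {0..t} f" for t
  have dF: "(F has_vector_derivative f t) (at t within {0..b})" if "0 \<le> t" "t \<le> b" for t b
    unfolding F_def using that
    by (intro integral_has_vector_derivative continuous_on_subset[OF cont]) auto
  \<comment> \<open>Differentiating the shift identity gives f' = (f (t + a) - f t) / A, and
    multiplicativity turns this into - c * f t.\<close>
  define c where "c = (1 - f a) / A"
  have df: "(f has_vector_derivative - c * f t) (at t within {0..b})" if "0 \<le> t" "t \<le> b" for t b
  proof -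
    have "((\<lambda>t. F (t + a)) has_vector_derivative f (t + a)) (at t within {0..b})"
    proof -
      have "(F has_vector_derivative f (t + a)) (at (t + a) within (\<lambda>t. t + a) ` {0..b})"
        using a that by (intro has_vector_derivative_within_subset[OF dF[of "t+a" "b+a"]]) auto
      moreover have "((\<lambda>t. t + a) has_vector_derivative 1) (at t within {0..b})"
        by (auto intro!: derivative_eq_intros)
      ultimately have "(F \<circ> (\<lambda>t. t + a) has_vector_derivative 1 *\<^sub>R f (t + a)) (at t within {0..b})"
        by (rule vector_diff_chain_within[rotated])
      then show ?thesis by (simp add: o_def)
    qed
    then have "((\<lambda>t. (F (t + a) - F t) / A) has_vector_derivative (f (t + a) - f t) / A) (at t within {0..b})"
      using dF[OF that] by (intro has_vector_derivative_divide has_vector_derivative_diff)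
    moreover have "(f (t + a) - f t) / A = - c * f t"
      using add[of t a] a that by (simp add: c_def divide_simps \<open>A \<noteq> 0\<close>) (simp add: algebra_simps)
    moreover have "(F (s + a) - F s) / A = f s" if "0 \<le> s" for s
      using shift[OF that] \<open>A \<noteq> 0\<close> by (simp add: F_def divide_simps)
    ultimately show ?thesis
      using that by (intro has_vector_derivative_transform[of t "{0..b}" f]) auto
  qed
  have "f t = exp (- (complex_of_real t * c))" if "0 \<le> t" for t
  proof -
    \<comment> \<open>The product of f with exp (s c) has derivative zero, hence equals its value 1
      at 0.\<close>
    have "((\<lambda>s. f s * exp (complex_of_real s * c)) has_vector_derivative 0) (at s within {0..t})"
      if s: "s \<in> {0..t}" for s
    proof -
      have "((\<lambda>s. exp (complex_of_real s * c)) has_vector_derivative c * exp (complex_of_real s * c)) (at s within {0..t})"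
        by (rule has_vector_derivative_real_field) (auto intro!: derivative_eq_intros)
      then have "((\<lambda>s. f s * exp (complex_of_real s * c)) has_vector_derivative
         f s * (c * exp (complex_of_real s * c)) + (- c * f s) * exp (complex_of_real s * c)) (at s within {0..t})"
        using s by (intro has_vector_derivative_mult df) auto
      then show ?thesis by (simp add: algebra_simps)
    qed
    then obtain k where "\<And>s. s \<in> {0..t} \<Longrightarrow> f s * exp (complex_of_real s * c) = k"
      using has_vector_derivative_zero_constant[of "{0..t}" "\<lambda>s. f s * exp (complex_of_real s * c)"] by auto
    from this[of t] this[of 0] have "f t * exp (complex_of_real t * c) = f 0 * exp (complex_of_real 0 * c)"
      using that by simp
    then show ?thesis by (simp add: f0 exp_minus field_simps)
  qed
  then show thesis by (rule that)
qed

section \<open>Characteristic functions of a Levy process\<close>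

context levy_process
begin

lemma integrable_iexp_levy:
  assumes "0 \<le> t" shows "integrable M (\<lambda>\<omega>. iexp (z \<bullet> W t \<omega>))"
  using random_variable[OF assms] by (intro integrable_const_bound[where B=1]) auto

lemma AE_iexp_increment_from_0:
  "AE \<omega> in M. iexp (z \<bullet> (W t \<omega> - W 0 \<omega>)) = iexp (z \<bullet> W t \<omega>)"
  using start_zero by eventually_elim simp

text \<open>Almost surely \<open>W (s + t)\<close> is the sum of the increments over [0, s] and
  [s, s + t]: independence factors the expectation, and stationarity identifies the second
  factor.\<close>

lemma levy_char_add:
  assumes s: "0 \<le> s" and t: "0 \<le> t"
  shows "(LINT \<omega>|M. iexp (z \<bullet> W (s + t) \<omega>)) =
    (LINT \<omega>|M. iexp (z \<bullet> W s \<omega>)) * (LINT \<omega>|M. iexp (z \<bullet> W t \<omega>))"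
proof -
  have rv [measurable]: "W 0 \<in> borel_measurable M" "W s \<in> borel_measurable M" "W t \<in> borel_measurable M"
     "W (s + t) \<in> borel_measurable M"
    using s t by (auto intro: random_variable)
  \<comment> \<open>The grid 0, s, s + t starts at 0 because independence speaks of increments;
    \<open>W 0 = 0\<close> almost surely turns the first increment into \<open>W s\<close>.\<close>
  define \<tau> where "\<tau> i = (if i = 0 then 0 else if i = 1 then s else s + t)" for i :: nat
  have "indep_vars (\<lambda>_. borel) (\<lambda>i \<omega>. W (\<tau> (Suc i)) \<omega> - W (\<tau> i) \<omega>) {..<2}"
    using s t by (intro independent_increments) (auto simp: \<tau>_def)
  then have indep: "indep_vars (\<lambda>_. borel) (\<lambda>i \<omega>. iexp (z \<bullet> (W (\<tau> (Suc i)) \<omega> - W (\<tau> i) \<omega>))) {..<2}"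
    by (rule indep_vars_compose2) measurable
  have two: "{..<2::nat} = {0, 1}" by auto
  have \<tau>0: "\<tau> 0 = 0" "\<tau> 1 = s" "\<tau> (Suc 0) = s" "\<tau> (Suc (Suc 0)) = s + t" by (auto simp: \<tau>_def)
  have "(LINT \<omega>|M. iexp (z \<bullet> W (s + t) \<omega>)) =
     (LINT \<omega>|M. (\<Prod>i<2. iexp (z \<bullet> (W (\<tau> (Suc i)) \<omega> - W (\<tau> i) \<omega>))))"
  proof (rule integral_cong_AE)
    show "AE \<omega> in M. iexp (z \<bullet> W (s + t) \<omega>) = (\<Prod>i<2. iexp (z \<bullet> (W (\<tau> (Suc i)) \<omega> - W (\<tau> i) \<omega>)))"
      using start_zero by eventually_elim
       (simp add: two \<tau>0 exp_add[symmetric] inner_diff_right distrib_left[symmetric] of_real_add[symmetric] del: of_real_diff of_real_add)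
  qed (auto simp: two \<tau>0)
  also have "\<dots> = (\<Prod>i<2. LINT \<omega>|M. iexp (z \<bullet> (W (\<tau> (Suc i)) \<omega> - W (\<tau> i) \<omega>)))"
    using indep by (rule indep_vars_lebesgue_integral[rotated])
      (auto simp: two \<tau>0 intro!: integrable_const_bound[where B=1])
  also have "\<dots> = (LINT \<omega>|M. iexp (z \<bullet> (W s \<omega> - W 0 \<omega>))) * (LINT \<omega>|M. iexp (z \<bullet> (W (s + t) \<omega> - W s \<omega>)))"
    by (simp add: two \<tau>0)
  also have "(LINT \<omega>|M. iexp (z \<bullet> (W s \<omega> - W 0 \<omega>))) = (LINT \<omega>|M. iexp (z \<bullet> W s \<omega>))"
    using AE_iexp_increment_from_0 by (intro integral_cong_AE) auto
  also have "(LINT \<omega>|M. iexp (z \<bullet> (W (s + t) \<omega> - W s \<omega>))) =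
      (LINT x|distr M borel (\<lambda>\<omega>. W (s + t) \<omega> - W s \<omega>). iexp (z \<bullet> x))"
    by (subst integral_distr) auto
  also have "\<dots> = (LINT \<omega>|M. iexp (z \<bullet> W t \<omega>))"
    unfolding stationary_increments[OF s t] by (subst integral_distr) auto
  finally show ?thesis .
qed

lemma levy_char_0: "(LINT \<omega>|M. iexp (z \<bullet> W 0 \<omega>)) = 1"
proof -
  have "(LINT \<omega>|M. iexp (z \<bullet> W 0 \<omega>)) = (LINT \<omega>|M. 1)"
    using start_zero random_variable[of 0] by (intro integral_cong_AE) (auto elim!: eventually_mono)
  then show ?thesis by (simp add: prob_space)
qed

lemma cmod_levy_char_le_1: "cmod (LINT \<omega>|M. iexp (z \<bullet> W t \<omega>)) \<le> 1"
  using integral_norm_bound[of M "\<lambda>\<omega>. iexp (z \<bullet> W t \<omega>)"] by (simp add: prob_space)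

text \<open>Right continuity of the paths at 0 gives pointwise convergence along sequences; the
  integrands have modulus 1, so convergence is dominated.\<close>

lemma levy_char_tendsto_1: "((\<lambda>t. LINT \<omega>|M. iexp (z \<bullet> W t \<omega>)) \<longlongrightarrow> 1) (at_right 0)"
proof (rule tendsto_at_right_sequentially)
  show "0 < (1::real)" by simp
  fix S :: "nat \<Rightarrow> real"
  assume S: "\<And>n. 0 < S n" "S \<longlonglongrightarrow> 0"
  have "(\<lambda>n. LINT \<omega>|M. iexp (z \<bullet> W (S n) \<omega>)) \<longlonglongrightarrow> (LINT \<omega>|M. 1)"
  proof (rule integral_dominated_convergence[where w="\<lambda>_. 1"])
    show "(\<lambda>\<omega>. iexp (z \<bullet> W (S n) \<omega>)) \<in> borel_measurable M" for n
      using random_variable[of "S n"] S(1)[of n] by simp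
    show "AE \<omega> in M. (\<lambda>n. iexp (z \<bullet> W (S n) \<omega>)) \<longlonglongrightarrow> 1"
      using start_zero cadlag_paths
    proof eventually_elim
      case (elim \<omega>)
      then have "((\<lambda>t. W t \<omega>) \<longlongrightarrow> 0) (at_right 0)"
        by (auto simp: cadlag_def continuous_within dest!: spec[of _ 0])
      moreover have "filterlim S (at_right 0) sequentially"
        using S less_imp_neq[OF S(1)] by (auto simp: filterlim_at intro!: always_eventually)
      ultimately have "(\<lambda>n. W (S n) \<omega>) \<longlonglongrightarrow> 0" by (rule filterlim_compose)
      then have "(\<lambda>n. iexp (z \<bullet> W (S n) \<omega>)) \<longlonglongrightarrow> iexp (z \<bullet> 0)" by (intro tendsto_intros)
      then show ?case by simp
    qed
  qed auto
  then show "(\<lambda>n. LINT \<omega>|M. iexp (z \<bullet> W (S n) \<omega>)) \<longlonglongrightarrow> 1" by (simp add: prob_space)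
qed

text \<open>In t the characteristic functions are multiplicative, bounded by 1 and right continuous
  at 0, hence exponential. So the definite description in \<open>levy_exponent\<close> is
  met.\<close>

lemma levy_char_eq:
  assumes "0 \<le> t"
  shows "(LINT \<omega>|M. iexp (z \<bullet> W t \<omega>)) = exp (- (complex_of_real t * levy_exponent M W z))"
proof -
  obtain c where c: "\<And>t. 0 \<le> t \<Longrightarrow> (LINT \<omega>|M. iexp (z \<bullet> W t \<omega>)) = exp (- (complex_of_real t * c))"
    using continuous_multiplicative_imp_exp[of "\<lambda>t. LINT \<omega>|M. iexp (z \<bullet> W t \<omega>)",
        OF levy_char_add cmod_levy_char_le_1 levy_char_tendsto_1 levy_char_0] by blast
  with levy_exponent_eqI[of M z W c] show ?thesis using assms by simp
qed

lemma Re_levy_exponent_nonneg: "0 \<le> Re (levy_exponent M W z)"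
  using cmod_levy_char_le_1[of z 1] by (simp add: levy_char_eq)

section \<open>Continuity of the exponent\<close>

lemma isCont_levy_char:
  assumes "0 \<le> t" shows "isCont (\<lambda>z. LINT \<omega>|M. iexp (z \<bullet> W t \<omega>)) z"
  unfolding continuous_at_sequentially o_def
proof (intro allI impI)
  fix S assume S: "S \<longlonglongrightarrow> z"
  show "(\<lambda>n. LINT \<omega>|M. iexp (S n \<bullet> W t \<omega>)) \<longlonglongrightarrow> (LINT \<omega>|M. iexp (z \<bullet> W t \<omega>))"
    using random_variable[OF assms] S
    by (intro integral_dominated_convergence[where w="\<lambda>_. 1"]) (auto intro!: tendsto_intros AE_I2)
qed


text \<open>
  The resolvent \<open>1 / (1 + \<psi> z)\<close> is the Laplace transform at 1 of the characteristic functions,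
  so it inherits their continuity in \<open>z\<close>.
\<close>

lemma isCont_levy_exponent: "isCont (levy_exponent M W) z"
proof -
  let ?\<psi> = "levy_exponent M W"
  have nz: "1 + ?\<psi> x \<noteq> 0" for x
    using Re_levy_exponent_nonneg[of x] by (auto simp: complex_eq_iff)
  define f where "f x t = indicator {0..} t *\<^sub>R exp (- (complex_of_real t * (1 + ?\<psi> x)))" for x t
  \<comment> \<open>The exponential form of the integrand can be integrated explicitly; this form
    shows domination by e^(-t) and continuity in x.\<close>
  have f_eq: "f x t = indicator {0..} t *\<^sub>R (complex_of_real (exp (- t)) * (LINT \<omega>|M. iexp (x \<bullet> W t \<omega>)))" for x t
    by (auto simp: f_def indicator_def levy_char_eq exp_of_real[symmetric] exp_add[symmetric] algebra_simps)
  have norm_f: "norm (f x t) \<le> exponential_density 1 t" for x t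
    using cmod_levy_char_le_1[of x t]
    by (auto simp: f_eq indicator_def exponential_density_def norm_mult)
  have meas [measurable]: "f x \<in> borel_measurable borel" for x
    unfolding f_def by measurable
  have dens: "integrable lborel (exponential_density 1)"
  proof (rule integrableI_nonneg)
    interpret E: prob_space "density lborel (exponential_density 1)"
      by (rule prob_space_exponential_density) simp
    show "(\<integral>\<^sup>+ x. ennreal (exponential_density 1 x) \<partial>lborel) < \<infinity>"
      using E.emeasure_space_1 by (simp add: emeasure_density)
  qed (auto simp: exponential_density_def)
  have int: "integrable lborel (f x)" for x
    using norm_f by (intro Bochner_Integration.integrable_bound[OF dens]) (auto intro!: AE_I2 order_trans[OF norm_f])
  \<comment> \<open>The antiderivative - exp (- t a) / a vanishes at infinity because Re a \<ge>
    1.\<close>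
  have val: "(LINT t|lborel. f x t) = 1 / (1 + ?\<psi> x)" for x
  proof -
    define a where "a = 1 + ?\<psi> x"
    have a: "a \<noteq> 0" "1 \<le> Re a" using nz[of x] Re_levy_exponent_nonneg[of x] by (auto simp: a_def)
    define F where "F t = - exp (- (complex_of_real t * a)) / a" for t
    have "(LINT t|lborel. f x t) = (LINT t:{0<..}|lborel. exp (- (complex_of_real t * a)))"
      unfolding set_lebesgue_integral_def
      by (rule integral_cong_AE, measurable, rule AE_mp[OF AE_lborel_singleton[of 0]])
         (auto simp: f_def a_def indicator_def)
    also have "\<dots> = (LBINT t=ereal 0..\<infinity>. exp (- (complex_of_real t * a)))"
      by (rule interval_integral_to_infinity_eq[symmetric])
    also have "\<dots> = 0 - (- 1 / a)"
    proof (rule interval_integral_FTC_integrable[where F=F])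
      show "(F has_vector_derivative exp (- (complex_of_real t * a))) (at t)" for t
        unfolding F_def using a(1)
        by (intro has_vector_derivative_real_field) (auto intro!: derivative_eq_intros)
      have "set_integrable lborel {0..} (\<lambda>t. exp (- (complex_of_real t * a)))"
        using int[of x] by (simp add: set_integrable_def f_def[abs_def] a_def)
      then show "set_integrable lborel (einterval (ereal 0) \<infinity>) (\<lambda>t. exp (- (complex_of_real t * a)))"
        by (rule set_integrable_subset) (auto simp: einterval_def)
      have "(F \<longlongrightarrow> - exp (- (complex_of_real 0 * a)) / a) (at_right 0)"
        unfolding F_def using a(1) by (intro tendsto_intros)
      then show "((F \<circ> real_of_ereal) \<longlongrightarrow> - 1 / a) (at_right (ereal 0))"
        by (simp add: ereal_tendsto_simps)
      have "((\<lambda>t. exp (- t) / cmod a) \<longlongrightarrow> 0 / cmod a) at_top"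
        using a by (intro tendsto_divide filterlim_compose[OF exp_at_bot filterlim_uminus_at_bot_at_top]) auto
      then have lim0: "((\<lambda>t. exp (- t) / cmod a) \<longlongrightarrow> 0) at_top" by simp
      have "(F \<longlongrightarrow> 0) at_top"
      proof (rule Lim_null_comparison[OF _ lim0])
        show "\<forall>\<^sub>F t in at_top. cmod (F t) \<le> exp (- t) / cmod a"
          using eventually_ge_at_top[of 0]
        proof eventually_elim
          case (elim t)
          then have "t * 1 \<le> t * Re a" using a by (intro mult_left_mono) auto
          then show ?case by (simp add: F_def norm_divide divide_right_mono)
        qed
      qed
      then show "((F \<circ> real_of_ereal) \<longlongrightarrow> 0) (at_left \<infinity>)"
        by (simp add: ereal_tendsto_simps)
    qed auto
    finally show ?thesis by (simp add: a_def)
  qed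
  have "(\<lambda>n. LINT t|lborel. f (S n) t) \<longlonglongrightarrow> (LINT t|lborel. f z t)" if S: "S \<longlonglongrightarrow> z" for S
  proof (rule integral_dominated_convergence[where w="exponential_density 1"])
    show "AE t in lborel. (\<lambda>n. f (S n) t) \<longlonglongrightarrow> f z t"
    proof (rule AE_I2)
      fix t :: real
      show "(\<lambda>n. f (S n) t) \<longlonglongrightarrow> f z t"
      proof (cases "0 \<le> t")
        case True
        then show ?thesis unfolding f_eq
          by (intro tendsto_intros isCont_tendsto_compose[OF isCont_levy_char S])
      qed (simp add: f_def)
    qed
  qed (auto simp: dens norm_f)
  then have "isCont (\<lambda>x. LINT t|lborel. f x t) z"
    unfolding continuous_at_sequentially o_def by blast
  moreover have "(LINT t|lborel. f z t) \<noteq> 0" using nz[of z] by (simp add: val)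
  \<comment> \<open>Recovering \<psi> from the reciprocal of the resolvent avoids choosing a branch
    of the complex logarithm.\<close>
  ultimately have "isCont (\<lambda>x. 1 / (LINT t|lborel. f x t) - 1) z"
    by (intro continuous_intros)
  then show ?thesis by (simp add: val)
qed

section \<open>Quadratic growth of the exponent\<close>

text \<open>This is the derivative of 1 - exp (- w c) at w = 0. It carries inequalities for
  characteristic functions over to \<psi>.\<close>

lemma levy_exponent_limit:
  "((\<lambda>t. (1 - (LINT \<omega>|M. iexp (z \<bullet> W t \<omega>))) / complex_of_real t) \<longlongrightarrow> levy_exponent M W z) (at_right 0)"
proof -
  let ?c = "levy_exponent M W z"
  have "((\<lambda>w. 1 - exp (- (w * ?c))) has_field_derivative ?c) (at 0)"
    by (auto intro!: derivative_eq_intros)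
  then have "((\<lambda>w. (1 - exp (- (w * ?c))) / w) \<longlongrightarrow> ?c) (at 0)"
    by (simp add: has_field_derivative_iff)
  moreover have "filterlim complex_of_real (at 0) (at_right 0)"
    unfolding filterlim_at by (auto intro!: tendsto_eq_intros simp: eventually_at_filter)
  ultimately have "((\<lambda>t. (1 - exp (- (complex_of_real t * ?c))) / complex_of_real t) \<longlongrightarrow> ?c) (at_right 0)"
    by (rule filterlim_compose)
  moreover have "\<forall>\<^sub>F t in at_right 0. (1 - exp (- (complex_of_real t * ?c))) / complex_of_real t =
      (1 - (LINT \<omega>|M. iexp (z \<bullet> W t \<omega>))) / complex_of_real t"
    by (auto simp: eventually_at_filter levy_char_eq)
  ultimately show ?thesis by (rule Lim_transform_eventually)
qed

text \<open>With \<open>k\<close> free, this is the Cauchy-Schwarz bound for the expectation of \<open>(1 - e\<^sup>i\<^sup>x\<^sup>W) (1 - e\<^sup>i\<^sup>y\<^sup>W)\<close>.\<close>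

lemma levy_char_almost_additive:
  assumes t: "0 \<le> t" and k: "0 < k"
  defines "\<phi> \<equiv> \<lambda>z. LINT \<omega>|M. iexp (z \<bullet> W t \<omega>)"
  shows "cmod ((1 - \<phi> x) + (1 - \<phi> y) - (1 - \<phi> (x + y))) \<le> k * Re (1 - \<phi> x) + Re (1 - \<phi> y) / k"
proof -
  define U where "U z \<omega> = 1 - iexp (z \<bullet> W t \<omega>)" for z \<omega>
  have int [simp]: "integrable M (\<lambda>\<omega>. iexp (z \<bullet> W t \<omega>))" for z
    using t by (rule integrable_iexp_levy)
  have intU: "integrable M (U z)" "(LINT \<omega>|M. U z \<omega>) = 1 - \<phi> z" for z
    unfolding U_def[abs_def] \<phi>_def by (simp_all add: prob_space)
  \<comment> \<open>With |1 - e^(i s)|^2 = 2 (1 - cos s), squares become real parts, whose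
    expectations are again expressed by \<open>\<phi>\<close>.\<close>
  have sq: "(cmod (U z \<omega>))\<^sup>2 = 2 * Re (U z \<omega>)" for z \<omega>
    using sin_cos_squared_add[of "z \<bullet> W t \<omega>"]
    by (simp add: U_def cmod_power2 Re_exp Im_exp power2_diff)
  \<comment> \<open>The identity (1 - u) (1 - v) = (1 - u) + (1 - v) - (1 - u v) for the two
    exponentials.\<close>
  have eq: "U x \<omega> * U y \<omega> = U x \<omega> + U y \<omega> - U (x + y) \<omega>" for \<omega>
    by (simp add: U_def inner_add_left distrib_left exp_add algebra_simps)
  have "(1 - \<phi> x) + (1 - \<phi> y) - (1 - \<phi> (x + y)) = (LINT \<omega>|M. U x \<omega> * U y \<omega>)"
    unfolding eq using intU by simp
  also have "cmod \<dots> \<le> (LINT \<omega>|M. cmod (U x \<omega> * U y \<omega>))" by (rule integral_norm_bound)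
  also have "\<dots> \<le> (LINT \<omega>|M. k * Re (U x \<omega>) + Re (U y \<omega>) / k)"
  proof (rule integral_mono)
    show "integrable M (\<lambda>\<omega>. cmod (U x \<omega> * U y \<omega>))"
      unfolding eq using intU by (intro integrable_norm) simp
    show "integrable M (\<lambda>\<omega>. k * Re (U x \<omega>) + Re (U y \<omega>) / k)" using intU by simp
    fix \<omega>
    have "0 \<le> (k * cmod (U x \<omega>) - cmod (U y \<omega>))\<^sup>2 / (2 * k)" using k by simp
    also have "\<dots> = k * ((cmod (U x \<omega>))\<^sup>2 / 2) + ((cmod (U y \<omega>))\<^sup>2 / 2) / k - cmod (U x \<omega>) * cmod (U y \<omega>)"
      using k by (simp add: field_simps power2_eq_square)
    finally show "cmod (U x \<omega> * U y \<omega>) \<le> k * Re (U x \<omega>) + Re (U y \<omega>) / k"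
      unfolding sq norm_mult by simp
  qed
  also have "\<dots> = k * Re (LINT \<omega>|M. U x \<omega>) + Re (LINT \<omega>|M. U y \<omega>) / k"
    using intU(1) by simp
  finally show ?thesis unfolding intU(2) .
qed

text \<open>Divide the bound for characteristic functions by t and let t tend to 0. The best k would
  give subadditivity of the square root of |\<psi>|; a free k avoids roots.\<close>

lemma levy_exponent_add_le:
  assumes k: "0 < k"
  shows "cmod (levy_exponent M W (x + y)) \<le>
    (1 + k) * cmod (levy_exponent M W x) + (1 + 1 / k) * cmod (levy_exponent M W y)"
proof -
  let ?\<psi> = "levy_exponent M W"
  let ?q = "\<lambda>z t. (1 - (LINT \<omega>|M. iexp (z \<bullet> W t \<omega>))) / complex_of_real t"
  have "cmod (?\<psi> x + ?\<psi> y - ?\<psi> (x + y)) \<le> k * Re (?\<psi> x) + Re (?\<psi> y) / k"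
  proof (rule tendsto_le)
    show "((\<lambda>t. cmod (?q x t + ?q y t - ?q (x + y) t)) \<longlongrightarrow> cmod (?\<psi> x + ?\<psi> y - ?\<psi> (x + y))) (at_right 0)"
      by (intro tendsto_intros levy_exponent_limit)
    show "((\<lambda>t. k * Re (?q x t) + Re (?q y t) / k) \<longlongrightarrow> k * Re (?\<psi> x) + Re (?\<psi> y) / k) (at_right 0)"
      using k by (intro tendsto_intros levy_exponent_limit) auto
    have "cmod (?q x t + ?q y t - ?q (x + y) t) \<le> k * Re (?q x t) + Re (?q y t) / k" if t: "0 < t" for t
    proof -
      have "?q x t + ?q y t - ?q (x + y) t = ((1 - (LINT \<omega>|M. iexp (x \<bullet> W t \<omega>))) + (1 - (LINT \<omega>|M. iexp (y \<bullet> W t \<omega>)))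
          - (1 - (LINT \<omega>|M. iexp ((x + y) \<bullet> W t \<omega>)))) / complex_of_real t"
        by (simp add: add_divide_distrib diff_divide_distrib)
      also have "cmod \<dots> \<le> (k * Re (1 - (LINT \<omega>|M. iexp (x \<bullet> W t \<omega>))) + Re (1 - (LINT \<omega>|M. iexp (y \<bullet> W t \<omega>))) / k) / t"
        unfolding norm_divide using levy_char_almost_additive[of t k x y] t k
        by (simp add: divide_right_mono)
      also have "\<dots> = k * Re (?q x t) + Re (?q y t) / k"
        by (simp add: add_divide_distrib)
      finally show ?thesis .
    qed
    then show "\<forall>\<^sub>F t in at_right 0. cmod (?q x t + ?q y t - ?q (x + y) t) \<le> k * Re (?q x t) + Re (?q y t) / k"
      by (auto simp: eventually_at_filter)
  qed simp
  also have "\<dots> \<le> k * cmod (?\<psi> x) + cmod (?\<psi> y) / k"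
    using k by (intro add_mono mult_left_mono divide_right_mono complex_Re_le_cmod) auto
  finally have "cmod (?\<psi> x + ?\<psi> y - ?\<psi> (x + y)) \<le> k * cmod (?\<psi> x) + cmod (?\<psi> y) / k" .
  moreover have "cmod (?\<psi> (x + y)) \<le> cmod (?\<psi> x) + cmod (?\<psi> y) + cmod (?\<psi> x + ?\<psi> y - ?\<psi> (x + y))"
    using norm_triangle_ineq4[of "?\<psi> x + ?\<psi> y" "?\<psi> x + ?\<psi> y - ?\<psi> (x + y)"] norm_triangle_ineq[of "?\<psi> x" "?\<psi> y"]
    by simp
  ultimately show ?thesis by (simp add: algebra_simps)
qed

text \<open>Induction on the multiple m with weight k = 1 / m, for which (1 + 1 / m) m^2 + (1 + m) =
  (m + 1)^2. Writing \<open>Suc n\<close> keeps m positive.\<close>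

lemma levy_exponent_scale_le:
  "cmod (levy_exponent M W (real (Suc n) *\<^sub>R z)) \<le> (real (Suc n))\<^sup>2 * cmod (levy_exponent M W z)"
proof (induction n)
  case (Suc n)
  let ?\<psi> = "levy_exponent M W"
  define m where "m = real (Suc n)"
  have m: "m > 0" by (simp add: m_def)
  have "cmod (?\<psi> (m *\<^sub>R z + z)) \<le> (1 + 1 / m) * cmod (?\<psi> (m *\<^sub>R z)) + (1 + 1 / (1 / m)) * cmod (?\<psi> z)"
    using m by (intro levy_exponent_add_le) auto
  also have "\<dots> \<le> (1 + 1 / m) * (m\<^sup>2 * cmod (?\<psi> z)) + (1 + 1 / (1 / m)) * cmod (?\<psi> z)"
    using Suc m unfolding m_def[symmetric] by (intro add_mono mult_left_mono) auto
  also have "\<dots> = (m + 1)\<^sup>2 * cmod (?\<psi> z)"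
    using m by (simp add: field_simps power2_eq_square)
  finally have "cmod (?\<psi> (m *\<^sub>R z + z)) \<le> (m + 1)\<^sup>2 * cmod (?\<psi> z)" .
  moreover have "real (Suc (Suc n)) = m + 1" by (simp add: m_def)
  ultimately show ?case by (simp only: scaleR_add_left scaleR_one)
qed simp

text \<open>Continuity bounds \<psi> on the closed unit ball, and every z is an integer multiple of
  a point of that ball.\<close>

lemma levy_exponent_quadratic_growth:
  obtains C where "\<And>z. cmod (levy_exponent M W z) \<le> C * (1 + norm z)\<^sup>2"
proof -
  let ?\<psi> = "levy_exponent M W"
  have "compact (?\<psi> ` cball 0 1)"
    by (intro compact_continuous_image continuous_at_imp_continuous_on ballI isCont_levy_exponent) simp
  then obtain C where C: "\<And>z. norm z \<le> 1 \<Longrightarrow> cmod (?\<psi> z) \<le> C"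
    using compact_imp_bounded bounded_iff by (metis (no_types, lifting) image_eqI mem_cball_0)
  have C0: "0 \<le> C" using order_trans[OF norm_ge_zero C[of 0]] by simp
  have "cmod (?\<psi> z) \<le> C * (1 + norm z)\<^sup>2" for z
  proof -
    \<comment> \<open>With the floor, \<open>Suc n\<close> exceeds \<open>norm z\<close>, so z
      divided by it lies in the unit ball, yet \<open>Suc n\<close> is at most 1 + norm z.\<close>
    define n where "n = nat \<lfloor>norm z\<rfloor>"
    have n: "norm z \<le> real (Suc n)" "real (Suc n) \<le> 1 + norm z"
      unfolding n_def by (simp, linarith) (simp)
    have "cmod (?\<psi> (real (Suc n) *\<^sub>R (z /\<^sub>R real (Suc n)))) \<le> (real (Suc n))\<^sup>2 * cmod (?\<psi> (z /\<^sub>R real (Suc n)))"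
      by (rule levy_exponent_scale_le)
    also have "\<dots> \<le> (1 + norm z)\<^sup>2 * C"
      using n by (intro mult_mono power_mono C) (auto simp: divide_simps)
    finally show ?thesis by (simp add: mult.commute)
  qed
  then show thesis by (rule that)
qed

end

section \<open>The exponent of an independent pair\<close>

text \<open>Independence makes the characteristic function of the pair a product, so exponents add.
  The defining equation is verified directly and uniqueness does the rest, without first showing
  that the pair is a Levy process.\<close>

lemma levy_exponent_Pair:
  assumes "levy_process M X" "levy_process M Y" "indep_processes M X Y"
  shows "levy_exponent M (\<lambda>t \<omega>. (X t \<omega>, Y t \<omega>)) (z, w) = levy_exponent M X z + levy_exponent M Y w"
proof (rule levy_exponent_eqI)
  interpret X: levy_process M X by fact
  interpret Y: levy_process M Y by fact
  fix t :: real assume t: "0 \<le> t"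
  have rv [measurable]: "X t \<in> borel_measurable M" "Y t \<in> borel_measurable M"
    using t by (auto intro: X.random_variable Y.random_variable)
  \<comment> \<open>Both exponentials are complex valued, so \<open>indep_var\<close> applies to
    them although the state spaces differ; the events they generate are process events.\<close>
  have sub: "sigma_sets (space M) {(\<lambda>\<omega>. iexp (u \<bullet> W t \<omega>)) -` A \<inter> space M | A. A \<in> sets borel} \<subseteq> process_events M W"
    for W :: "real \<Rightarrow> 'a \<Rightarrow> 'd::euclidean_space" and u
    unfolding process_events_def
  proof (rule sigma_sets_mono', safe)
    fix A :: "complex set" assume A: "A \<in> sets borel"
    have "(\<lambda>x. iexp (u \<bullet> x)) -` A \<in> sets borel"
      using measurable_sets[OF _ A, of "\<lambda>x. iexp (u \<bullet> x)" borel] by simp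
    with t show "\<exists>s B. (\<lambda>\<omega>. iexp (u \<bullet> W t \<omega>)) -` A \<inter> space M = W s -` B \<inter> space M \<and> 0 \<le> s \<and> B \<in> sets borel"
      by (intro exI[of _ t] exI[of _ "(\<lambda>x. iexp (u \<bullet> x)) -` A"]) auto
  qed
  have "X.indep_set (process_events M X) (process_events M Y)"
    using assms(3) by (simp add: indep_processes_def)
  then have pe: "process_events M X \<subseteq> X.events" "process_events M Y \<subseteq> X.events"
    "\<And>A B. A \<in> process_events M X \<Longrightarrow> B \<in> process_events M Y \<Longrightarrow> X.prob (A \<inter> B) = X.prob A * X.prob B"
    by (simp_all add: X.indep_sets2_eq)
  have "X.indep_set (sigma_sets (space M) {(\<lambda>\<omega>. iexp (z \<bullet> X t \<omega>)) -` A \<inter> space M | A. A \<in> sets borel})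
      (sigma_sets (space M) {(\<lambda>\<omega>. iexp (w \<bullet> Y t \<omega>)) -` A \<inter> space M | A. A \<in> sets borel})"
    unfolding X.indep_sets2_eq
    by (intro conjI ballI order_trans[OF sub pe(1)] order_trans[OF sub pe(2)] pe(3) subsetD[OF sub])
  then have "X.indep_var borel (\<lambda>\<omega>. iexp (z \<bullet> X t \<omega>)) borel (\<lambda>\<omega>. iexp (w \<bullet> Y t \<omega>))"
    unfolding X.indep_var_eq by simp
  then have "(LINT \<omega>|M. iexp (z \<bullet> X t \<omega>) * iexp (w \<bullet> Y t \<omega>)) =
     (LINT \<omega>|M. iexp (z \<bullet> X t \<omega>)) * (LINT \<omega>|M. iexp (w \<bullet> Y t \<omega>))"
    using t by (intro X.indep_var_lebesgue_integral X.integrable_iexp_levy Y.integrable_iexp_levy)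
  moreover have "iexp ((z, w) \<bullet> (X t \<omega>, Y t \<omega>)) = iexp (z \<bullet> X t \<omega>) * iexp (w \<bullet> Y t \<omega>)" for \<omega>
    by (simp add: distrib_left exp_add)
  ultimately show "(LINT \<omega>|M. iexp ((z, w) \<bullet> (X t \<omega>, Y t \<omega>))) =
      exp (- (complex_of_real t * (levy_exponent M X z + levy_exponent M Y w)))"
    by (simp only: X.levy_char_eq[OF t] Y.levy_char_eq[OF t] exp_add[symmetric] distrib_left minus_add_distrib)
qed

section \<open>Energy of the marginals\<close>

text \<open>Write Re (1 / c) = Re c / |c|^2. Adding b does not lower the numerator, and |a| \<ge>
  lam gives |a + b| \<le> (1 + |b| / lam) |a|.\<close>

lemma Re_inverse_le_Re_inverse_add:
  fixes a b :: complex
  assumes lam: "0 < lam" "lam \<le> Re a" and b: "0 \<le> Re b"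
  shows "Re (inverse a) \<le> (1 + cmod b / lam)\<^sup>2 * Re (inverse (a + b))"
proof -
  have Re_inv: "Re (inverse c) = Re c / (cmod c)\<^sup>2" for c
    by (simp add: cmod_power2)
  have pos: "0 < (cmod a)\<^sup>2" "0 < (cmod (a + b))\<^sup>2" using lam b by (auto simp: complex_eq_iff)
  have "lam \<le> cmod a" using lam(2) complex_Re_le_cmod[of a] by simp
  then have "cmod b * lam \<le> cmod b * cmod a" by (intro mult_left_mono) auto
  then have "cmod b \<le> cmod b / lam * cmod a" using lam by (simp add: field_simps)
  then have "cmod (a + b) \<le> (1 + cmod b / lam) * cmod a"
    using norm_triangle_ineq[of a b] by (simp add: algebra_simps)
  then have "(cmod (a + b))\<^sup>2 \<le> ((1 + cmod b / lam) * cmod a)\<^sup>2" by (rule power_mono) simp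
  then have "Re a * (cmod (a + b))\<^sup>2 \<le> Re (a + b) * ((1 + cmod b / lam)\<^sup>2 * (cmod a)\<^sup>2)"
    using lam b by (intro mult_mono) (auto simp: power_mult_distrib)
  then show ?thesis
    unfolding Re_inv using pos by (simp add: field_simps)
qed

text \<open>Here \<open>p x\<close> stands for the phase of the retained coordinate at a fixed
  frequency z, and \<open>V\<close> is the coordinate projected away. \<open>K\<close> is chosen
  before \<open>a\<close> and \<open>p\<close>, so the bound can afterwards be integrated over
  z.\<close>

lemma exists_energy_comparison_constant:
  fixes V :: "'a \<Rightarrow> 'c::euclidean_space" and \<psi> :: "'c \<Rightarrow> complex"
  assumes N: "finite_measure N" and V [measurable]: "V \<in> borel_measurable N"
    and R: "AE x in N. norm (V x) \<le> R"
    and \<psi> [measurable]: "\<psi> \<in> borel_measurable borel" and Re_\<psi>: "\<And>w. 0 \<le> Re (\<psi> w)"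
    and growth: "\<And>w. cmod (\<psi> w) \<le> C * (1 + norm w)\<^sup>2" and lam: "0 < lam"
  obtains K :: real where "\<And>a p. lam \<le> Re a \<Longrightarrow> p \<in> borel_measurable N \<Longrightarrow>
    ennreal (Re (inverse a) * (cmod (LINT x|N. iexp (p x)))\<^sup>2) \<le>
      ennreal K * (\<integral>\<^sup>+ w. ennreal (Re (inverse (a + \<psi> w)) * (cmod (LINT x|N. iexp (p x + w \<bullet> V x)))\<^sup>2) \<partial>lborel)"
proof -
  interpret N: finite_measure N by fact
  interpret P: pair_sigma_finite N "lborel :: 'c measure" ..
  \<comment> \<open>The kernel needs a nonnegative radius, while R may be negative if
    \<open>N\<close> is the zero measure.\<close>
  obtain H :: "'c \<Rightarrow> complex" and C' :: real where
    H: "integrable lborel H" and decay: "\<And>w. cmod (H w) \<le> C' / (1 + norm w) ^ 4"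
    and rep: "\<And>y. norm y \<le> max 0 R \<Longrightarrow> (LINT w|lborel. H w * iexp (w \<bullet> y)) = 1"
    using exists_reproducing_kernel[of "max 0 R"] by auto
  have [measurable]: "H \<in> borel_measurable borel" using borel_measurable_integrable[OF H] by simp
  have C0: "0 \<le> C" using order_trans[OF norm_ge_zero growth[of 0]] by simp
  have C'0: "0 \<le> C'" using order_trans[OF norm_ge_zero decay[of 0]] by simp
  define h where "h = (LINT w|lborel. cmod (H w))"
  define D where "D = C' * (1 + C / lam)\<^sup>2"
  have h0: "0 \<le> h" unfolding h_def by simp
  have D0: "0 \<le> D" using C'0 by (simp add: D_def)
  have h: "(\<integral>\<^sup>+ w. ennreal (cmod (H w)) \<partial>lborel) = ennreal h"
    unfolding h_def using H by (intro nn_integral_eq_integral) auto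
  \<comment> \<open>The squared factor is at most a multiple of (1 + norm w) ^ 4, exactly the order
    of decay of \<open>H\<close>; the powers cancel and the constant \<open>D\<close>
    remains.\<close>
  have weight: "Re (inverse a) * cmod (H w) \<le> D * Re (inverse (a + \<psi> w))" if a: "lam \<le> Re a" for a w
  proof -
    have n1: "1 \<le> (1 + norm w)\<^sup>2" by (simp add: one_le_power)
    have inv0: "0 \<le> Re (inverse (a + \<psi> w))" using a lam Re_\<psi>[of w] by (auto intro!: divide_nonneg_nonneg)
    have "1 + cmod (\<psi> w) / lam \<le> (1 + norm w)\<^sup>2 + C * (1 + norm w)\<^sup>2 / lam"
      using n1 growth[of w] lam by (intro add_mono divide_right_mono) auto
    also have "\<dots> = (1 + C / lam) * (1 + norm w)\<^sup>2" by (simp add: algebra_simps)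
    finally have "(1 + cmod (\<psi> w) / lam)\<^sup>2 \<le> ((1 + C / lam) * (1 + norm w)\<^sup>2)\<^sup>2"
      using lam by (intro power_mono) auto
    also have "\<dots> = (1 + C / lam)\<^sup>2 * (1 + norm w) ^ 4"
      by (simp add: power_mult_distrib power_mult[symmetric])
    finally have le: "(1 + cmod (\<psi> w) / lam)\<^sup>2 \<le> (1 + C / lam)\<^sup>2 * (1 + norm w) ^ 4" .
    have "Re (inverse a) * cmod (H w) \<le> ((1 + cmod (\<psi> w) / lam)\<^sup>2 * Re (inverse (a + \<psi> w))) * cmod (H w)"
      using Re_inverse_le_Re_inverse_add[OF lam a Re_\<psi>] by (intro mult_right_mono) auto
    also have "\<dots> \<le> (((1 + C / lam)\<^sup>2 * (1 + norm w) ^ 4) * Re (inverse (a + \<psi> w))) * (C' / (1 + norm w) ^ 4)"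
      using inv0 decay[of w] le by (intro mult_mono mult_nonneg_nonneg) auto
    also have "\<dots> = D * Re (inverse (a + \<psi> w)) * ((1 + norm w) ^ 4 / (1 + norm w) ^ 4)"
      by (simp add: D_def)
    also have "(1 + norm w) ^ 4 / (1 + norm w) ^ 4 = 1"
      using add_pos_nonneg[of 1 "norm w"] by simp
    finally show ?thesis by simp
  qed
  have "ennreal (Re (inverse a) * (cmod (LINT x|N. iexp (p x)))\<^sup>2) \<le>
      ennreal (h * D) * (\<integral>\<^sup>+ w. ennreal (Re (inverse (a + \<psi> w)) * (cmod (LINT x|N. iexp (p x + w \<bullet> V x)))\<^sup>2) \<partial>lborel)"
    if a: "lam \<le> Re a" and p [measurable]: "p \<in> borel_measurable N" for a p
  proof -
    \<comment> \<open>If \<open>p x\<close> is z \<bullet> U x, this is the Fourier transform of the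
      joint image of \<open>N\<close> under (U, V) at (z, w).\<close>
    define G where "G w = (LINT x|N. iexp (p x + w \<bullet> V x))" for w
    have [measurable]: "G \<in> borel_measurable borel" unfolding G_def by measurable
    have G_le: "cmod (G w) \<le> measure N (space N)" for w
      using integral_norm_bound[of N "\<lambda>x. iexp (p x + w \<bullet> V x)"] by (simp add: G_def)
    have int: "integrable (N \<Otimes>\<^sub>M lborel) (\<lambda>(x, w). H w * iexp (p x + w \<bullet> V x))"
    proof (rule P.Fubini_integrable)
      show "integrable N (\<lambda>x. LINT w|lborel. norm (case (x, w) of (x, w) \<Rightarrow> H w * iexp (p x + w \<bullet> V x)))"
        by (simp add: norm_mult)
      show "AE x in N. integrable lborel (\<lambda>w. case (x, w) of (x, w) \<Rightarrow> H w * iexp (p x + w \<bullet> V x))"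
        using H by (intro AE_I2 Bochner_Integration.integrable_bound[OF H]) (auto simp: norm_mult)
    qed measurable
    \<comment> \<open>Insert the factor 1 = \<integral> H(w) e^(i w \<bullet> V x) dw, valid for
      almost every x; Fubini then moves the kernel outside.\<close>
    have "(LINT x|N. iexp (p x)) = (LINT x|N. LINT w|lborel. H w * iexp (p x + w \<bullet> V x))"
    proof (rule integral_cong_AE)
      show "AE x in N. iexp (p x) = (LINT w|lborel. H w * iexp (p x + w \<bullet> V x))"
        using R
      proof eventually_elim
        case (elim x)
        have "(LINT w|lborel. H w * iexp (p x + w \<bullet> V x)) = (LINT w|lborel. iexp (p x) * (H w * iexp (w \<bullet> V x)))"
          by (intro Bochner_Integration.integral_cong) (simp_all add: distrib_left exp_add)
        also have "\<dots> = iexp (p x) * (LINT w|lborel. H w * iexp (w \<bullet> V x))"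
          by (rule integral_mult_right_zero)
        finally show ?case using rep[of "V x"] elim by simp
      qed
    qed measurable
    also have "\<dots> = (LINT w|lborel. LINT x|N. H w * iexp (p x + w \<bullet> V x))"
      using P.Fubini_integral[OF int] by simp
    also have "\<dots> = (LINT w|lborel. H w * G w)" by (simp add: G_def)
    finally have eq: "(LINT x|N. iexp (p x)) = (LINT w|lborel. H w * G w)" .
    have "integrable lborel (\<lambda>w. H w * G w)"
    proof (rule Bochner_Integration.integrable_bound)
      show "integrable lborel (\<lambda>w. norm (H w) * measure N (space N))" using H by simp
      show "AE w in lborel. norm (H w * G w) \<le> norm (norm (H w) * measure N (space N))"
        by (intro AE_I2) (simp add: norm_mult mult_left_mono G_le)
    qed measurable
    then have "ennreal (cmod (LINT x|N. iexp (p x))) \<le> (\<integral>\<^sup>+ w. ennreal (cmod (H w * G w)) \<partial>lborel)"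
      unfolding eq by (rule integral_norm_bound_ennreal)
    \<comment> \<open>Splitting off the root of |H| lets the Cauchy-Schwarz inequality produce the
      mass \<open>h\<close> times the integral of |G|^2 weighted by |H|.\<close>
    also have "\<dots> = (\<integral>\<^sup>+ w. ennreal (sqrt (cmod (H w))) * ennreal (sqrt (cmod (H w)) * cmod (G w)) \<partial>lborel)"
      by (intro nn_integral_cong) (simp add: norm_mult ennreal_mult[symmetric] mult.assoc[symmetric])
    finally have "(ennreal (cmod (LINT x|N. iexp (p x))))\<^sup>2 \<le>
        (\<integral>\<^sup>+ w. ennreal (sqrt (cmod (H w))) * ennreal (sqrt (cmod (H w)) * cmod (G w)) \<partial>lborel)\<^sup>2"
      by (intro power_mono) auto
    also have "\<dots> \<le> (\<integral>\<^sup>+ w. (ennreal (sqrt (cmod (H w))))\<^sup>2 \<partial>lborel) *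
        (\<integral>\<^sup>+ w. (ennreal (sqrt (cmod (H w)) * cmod (G w)))\<^sup>2 \<partial>lborel)"
      by (rule Cauchy_Schwarz_nn_integral) measurable
    also have "\<dots> = ennreal h * (\<integral>\<^sup>+ w. ennreal (cmod (H w) * (cmod (G w))\<^sup>2) \<partial>lborel)"
      by (simp add: ennreal_power power_mult_distrib h)
    finally have CS: "ennreal ((cmod (LINT x|N. iexp (p x)))\<^sup>2) \<le>
        ennreal h * (\<integral>\<^sup>+ w. ennreal (cmod (H w) * (cmod (G w))\<^sup>2) \<partial>lborel)"
      by (simp add: ennreal_power)
    have inv0: "0 \<le> Re (inverse a)" using a lam by (auto intro!: divide_nonneg_nonneg)
    have "ennreal (Re (inverse a) * (cmod (LINT x|N. iexp (p x)))\<^sup>2) =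
        ennreal (Re (inverse a)) * ennreal ((cmod (LINT x|N. iexp (p x)))\<^sup>2)"
      using inv0 by (intro ennreal_mult) auto
    also have "\<dots> \<le> ennreal (Re (inverse a)) * (ennreal h * (\<integral>\<^sup>+ w. ennreal (cmod (H w) * (cmod (G w))\<^sup>2) \<partial>lborel))"
      using CS by (rule mult_left_mono) simp
    also have "\<dots> = ennreal h * (ennreal (Re (inverse a)) * (\<integral>\<^sup>+ w. ennreal (cmod (H w) * (cmod (G w))\<^sup>2) \<partial>lborel))"
      by (simp add: ac_simps)
    also have "ennreal (Re (inverse a)) * (\<integral>\<^sup>+ w. ennreal (cmod (H w) * (cmod (G w))\<^sup>2) \<partial>lborel) =
        (\<integral>\<^sup>+ w. ennreal (Re (inverse a)) * ennreal (cmod (H w) * (cmod (G w))\<^sup>2) \<partial>lborel)"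
      by (rule nn_integral_cmult[symmetric]) measurable
    also have "\<dots> \<le> (\<integral>\<^sup>+ w. ennreal D * ennreal (Re (inverse (a + \<psi> w)) * (cmod (G w))\<^sup>2) \<partial>lborel)"
    proof (rule nn_integral_mono)
      fix w
      have "Re (inverse a) * (cmod (H w) * (cmod (G w))\<^sup>2) \<le> D * (Re (inverse (a + \<psi> w)) * (cmod (G w))\<^sup>2)"
        using mult_right_mono[OF weight[OF a, of w], of "(cmod (G w))\<^sup>2"] by (simp add: mult.assoc)
      then show "ennreal (Re (inverse a)) * ennreal (cmod (H w) * (cmod (G w))\<^sup>2) \<le>
          ennreal D * ennreal (Re (inverse (a + \<psi> w)) * (cmod (G w))\<^sup>2)"
        using inv0 D0 by (simp only: ennreal_mult'[symmetric] ennreal_leI)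
    qed
    also have "\<dots> = ennreal D * (\<integral>\<^sup>+ w. ennreal (Re (inverse (a + \<psi> w)) * (cmod (G w))\<^sup>2) \<partial>lborel)"
      by (rule nn_integral_cmult) measurable
    finally show ?thesis
      unfolding G_def using h0 D0 by (simp add: ennreal_mult mult.assoc mult_left_mono)
  qed
  then show thesis by (rule that)
qed

text \<open>Integrate the comparison over z, its constant being uniform. With \<open>U\<close> and
  \<open>V\<close> abstract, the pairs (fst, snd) and (snd, fst) settle the two marginals
  alike.\<close>

lemma energy_marginal_finite:
  fixes U :: "'a \<Rightarrow> 'b::euclidean_space" and V :: "'a \<Rightarrow> 'c::euclidean_space"
    and \<psi>\<^sub>1 :: "'b \<Rightarrow> complex" and \<psi>\<^sub>2 :: "'c \<Rightarrow> complex"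
  assumes N: "finite_measure N" and U [measurable]: "U \<in> borel_measurable N"
    and V [measurable]: "V \<in> borel_measurable N" and R: "AE x in N. norm (V x) \<le> R"
    and \<psi>\<^sub>1 [measurable]: "\<psi>\<^sub>1 \<in> borel_measurable borel" and Re_\<psi>\<^sub>1: "\<And>z. 0 \<le> Re (\<psi>\<^sub>1 z)"
    and \<psi>\<^sub>2 [measurable]: "\<psi>\<^sub>2 \<in> borel_measurable borel" and Re_\<psi>\<^sub>2: "\<And>w. 0 \<le> Re (\<psi>\<^sub>2 w)"
    and growth: "\<And>w. cmod (\<psi>\<^sub>2 w) \<le> C * (1 + norm w)\<^sup>2" and lam: "0 < lam"
    and fin: "(\<integral>\<^sup>+ z. \<integral>\<^sup>+ w. ennreal (Re (inverse (complex_of_real lam + (\<psi>\<^sub>1 z + \<psi>\<^sub>2 w))) *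
        (cmod (LINT x|N. iexp (z \<bullet> U x + w \<bullet> V x)))\<^sup>2) \<partial>lborel \<partial>lborel) < \<infinity>"
  shows "(\<integral>\<^sup>+ z. ennreal (Re (inverse (complex_of_real lam + \<psi>\<^sub>1 z)) *
        (cmod (LINT x|N. iexp (z \<bullet> U x)))\<^sup>2) \<partial>lborel) < \<infinity>"
proof -
  interpret N: finite_measure N by fact
  obtain K where K: "\<And>a p. lam \<le> Re a \<Longrightarrow> p \<in> borel_measurable N \<Longrightarrow>
    ennreal (Re (inverse a) * (cmod (LINT x|N. iexp (p x)))\<^sup>2) \<le>
      ennreal K * (\<integral>\<^sup>+ w. ennreal (Re (inverse (a + \<psi>\<^sub>2 w)) * (cmod (LINT x|N. iexp (p x + w \<bullet> V x)))\<^sup>2) \<partial>lborel)"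
    using exists_energy_comparison_constant[OF N V R \<psi>\<^sub>2 Re_\<psi>\<^sub>2 growth lam] by blast
  have "(\<integral>\<^sup>+ z. ennreal (Re (inverse (complex_of_real lam + \<psi>\<^sub>1 z)) * (cmod (LINT x|N. iexp (z \<bullet> U x)))\<^sup>2) \<partial>lborel) \<le>
    (\<integral>\<^sup>+ z. ennreal K * (\<integral>\<^sup>+ w. ennreal (Re (inverse (complex_of_real lam + (\<psi>\<^sub>1 z + \<psi>\<^sub>2 w))) *
        (cmod (LINT x|N. iexp (z \<bullet> U x + w \<bullet> V x)))\<^sup>2) \<partial>lborel) \<partial>lborel)"
    using K[of "complex_of_real lam + \<psi>\<^sub>1 z" "\<lambda>x. z \<bullet> U x" for z] Re_\<psi>\<^sub>1
    by (intro nn_integral_mono) (simp add: add.assoc)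
  also have "\<dots> = ennreal K * (\<integral>\<^sup>+ z. \<integral>\<^sup>+ w. ennreal (Re (inverse (complex_of_real lam + (\<psi>\<^sub>1 z + \<psi>\<^sub>2 w))) *
        (cmod (LINT x|N. iexp (z \<bullet> U x + w \<bullet> V x)))\<^sup>2) \<partial>lborel \<partial>lborel)"
    by (rule nn_integral_cmult) measurable
  also have "\<dots> < \<infinity>" using fin by (simp add: ennreal_mult_less_top)
  finally show ?thesis .
qed

section \<open>The support of the measure and the two marginals\<close>

text \<open>The complement of the support is a union of open null sets, and the Lindelof property
  reduces it to a countable union.\<close>

lemma AE_in_measure_support:
  fixes \<nu> :: "'b::second_countable_topology measure"
  assumes sets: "sets \<nu> = sets borel"
  shows "AE x in \<nu>. x \<in> measure_support \<nu>"
proof -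
  define F where "F = {U. open U \<and> emeasure \<nu> U = 0}"
  obtain F' where F': "F' \<subseteq> F" "countable F'" "\<Union>F' = \<Union>F"
    using Lindelof[of F] unfolding F_def by blast
  have "(\<Union>U\<in>F'. U) \<in> null_sets \<nu>"
    using F'(1,2) sets by (intro null_sets_UN') (auto simp: F_def null_sets_def)
  then have "AE x in \<nu>. x \<notin> \<Union>F" unfolding F'(3)[symmetric] using AE_not_in by fastforce
  then show ?thesis
    by eventually_elim (auto simp: measure_support_def F_def zero_less_iff_neq_zero)
qed

theorem proposition4p5:
  fixes M :: "'a measure"
    and X :: "real \<Rightarrow> 'a \<Rightarrow> real ^ 'n"
    and Y :: "real \<Rightarrow> 'a \<Rightarrow> real ^ 'm"
    and Z :: "real \<Rightarrow> 'a \<Rightarrow> (real ^ 'n) \<times> (real ^ 'm)"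
    and \<nu> :: "((real ^ 'n) \<times> (real ^ 'm)) measure"
    and lam :: real
  assumes levy_X: "levy_process M X"
    and levy_Y: "levy_process M Y"
    and indep: "indep_processes M X Y"
    and Z_def: "Z = (\<lambda>t \<omega>. (X t \<omega>, Y t \<omega>))"
    and res_X: "has_resolvent_densities M X"
    and res_Y: "has_resolvent_densities M Y"
    and res_Z: "has_resolvent_densities M Z"
    and lam_pos: "0 < lam"
    and sets_nu: "sets \<nu> = sets borel"
    and finite_nu: "finite_measure \<nu>"
    and supp_nu: "compact (measure_support \<nu>)"
    and energy_Z: "energy M Z lam \<nu> < \<infinity>"
  shows "energy M X lam (distr \<nu> borel fst) < \<infinity>
       \<and> energy M Y lam (distr \<nu> borel snd) < \<infinity>"
proof -
  interpret X: levy_process M X by fact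
  interpret Y: levy_process M Y by fact
  interpret \<nu>: finite_measure \<nu> by fact
  let ?\<psi>X = "levy_exponent M X" and ?\<psi>Y = "levy_exponent M Y"
  have [measurable]: "?\<psi>X \<in> borel_measurable borel" "?\<psi>Y \<in> borel_measurable borel"
    by (intro borel_measurable_continuous_onI continuous_at_imp_continuous_on ballI
        X.isCont_levy_exponent Y.isCont_levy_exponent)+
  have sets_prod [measurable_cong]: "sets \<nu> = sets (borel \<Otimes>\<^sub>M borel)"
    unfolding sets_nu borel_prod ..
  define g where "g z w = ennreal (Re (inverse (complex_of_real lam + (?\<psi>X z + ?\<psi>Y w))) *
    (cmod (LINT x|\<nu>. iexp (z \<bullet> fst x + w \<bullet> snd x)))\<^sup>2)" for z w
  have g [measurable]: "case_prod g \<in> borel_measurable (lborel \<Otimes>\<^sub>M lborel)"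
    unfolding g_def by measurable
  \<comment> \<open>The exponent of the pair splits and \<open>lborel\<close> is a product measure,
    so Tonelli can evaluate the energy in either order.\<close>
  have "energy M Z lam \<nu> = (\<integral>\<^sup>+ p. case_prod g p \<partial>(lborel \<Otimes>\<^sub>M lborel))"
    unfolding energy_def lborel_prod Z_def
    by (intro nn_integral_cong)
      (auto simp: g_def fourier_transform_def levy_exponent_Pair[OF levy_X levy_Y indep] inner_prod_def)
  with energy_Z have fin: "(\<integral>\<^sup>+ p. case_prod g p \<partial>(lborel \<Otimes>\<^sub>M lborel)) < \<infinity>" by simp
  obtain R where R: "\<And>p. p \<in> measure_support \<nu> \<Longrightarrow> norm p \<le> R"
    using compact_imp_bounded[OF supp_nu] bounded_iff by blast
  have AE_R: "AE x in \<nu>. norm (fst x) \<le> R" "AE x in \<nu>. norm (snd x) \<le> R"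
    by (rule eventually_mono[OF AE_in_measure_support[OF sets_nu]],
        metis R norm_fst_le norm_snd_le order_trans prod.collapse)+
  obtain CX where CX: "\<And>z. cmod (?\<psi>X z) \<le> CX * (1 + norm z)\<^sup>2"
    using X.levy_exponent_quadratic_growth by blast
  obtain CY where CY: "\<And>w. cmod (?\<psi>Y w) \<le> CY * (1 + norm w)\<^sup>2"
    using Y.levy_exponent_quadratic_growth by blast
  have meas [measurable]: "fst \<in> borel_measurable \<nu>" "snd \<in> borel_measurable \<nu>"
    by measurable
  have "(\<integral>\<^sup>+ z. \<integral>\<^sup>+ w. g z w \<partial>lborel \<partial>lborel) < \<infinity>"
    using fin lborel.nn_integral_fst[OF g] by simp
  then have "(\<integral>\<^sup>+ z. ennreal (Re (inverse (complex_of_real lam + ?\<psi>X z)) *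
        (cmod (LINT x|\<nu>. iexp (z \<bullet> fst x)))\<^sup>2) \<partial>lborel) < \<infinity>"
    unfolding g_def
    by (intro energy_marginal_finite[OF finite_nu meas AE_R(2) _ X.Re_levy_exponent_nonneg _
          Y.Re_levy_exponent_nonneg CY lam_pos]) measurable
  then have "energy M X lam (distr \<nu> borel fst) < \<infinity>"
    unfolding energy_def fourier_transform_def by (subst integral_distr) measurable
  \<comment> \<open>For the second marginal the other order of integration is taken, and the sums
    inside \<open>g\<close> are commuted to fit the exchanged roles of the coordinates.\<close>
  moreover have "(\<integral>\<^sup>+ w. \<integral>\<^sup>+ z. g z w \<partial>lborel \<partial>lborel) < \<infinity>"
    using fin lborel_pair.nn_integral_snd[OF g] by simp
  then have "(\<integral>\<^sup>+ w. ennreal (Re (inverse (complex_of_real lam + ?\<psi>Y w)) *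
        (cmod (LINT x|\<nu>. iexp (w \<bullet> snd x)))\<^sup>2) \<partial>lborel) < \<infinity>"
    unfolding g_def add.commute[of "?\<psi>X _"] add.commute[of "_ \<bullet> fst _"]
    by (intro energy_marginal_finite[OF finite_nu meas(2,1) AE_R(1) _ Y.Re_levy_exponent_nonneg _
          X.Re_levy_exponent_nonneg CX lam_pos]) measurable
  then have "energy M Y lam (distr \<nu> borel snd) < \<infinity>"
    unfolding energy_def fourier_transform_def by (subst integral_distr) measurable
  ultimately show ?thesis ..
qed

end
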